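(* In the Rayleigh fading system model of the context with $M>1$ beams (and any $\rho>0$), the ergodic sum rate $R(\vec p)$ is a Schur-concave function of the feedback probabilities $\vec p\in[0,1]^n$. Consequently, a homogeneous threshold feedback policy solves the threshold selection problem: for every $\lambda\in(0,n]$ and every threshold vector $\vec\tau$ with $\sum_{i=1}^n\Pr\{\gamma_{i,1}\ge\tau_i\}\le\lambda$, there is a homogeneous threshold vector $\vec\tau'=(\tau,\dots,\tau)$ satisfying the same constraint with $R(\vec\tau')\ge R(\vec\tau)$.
   Context: System model: there are $n\ge 2$ users and $M\ge1$ beams. The SINR of user $i$ on beam $m$ is $\gamma_{i,m} = |X_{i,m}|^2 / \big(\tfrac1\rho + \sum_{k\ne m}|X_{i,k}|^2\big)$ with $\rho>0$, where (Rayleigh fading) the $X_{i,k}$ are i.i.d. unit-power circularly symmetric complex Gaussian; users are i.i.d., and the marginal distribution of each $\gamma_{i,m}$ is $F(x) = 1 - e^{-x/\rho}/(x+1)^{M-1}$, $x\ge0$, with density $f(x) = \frac{e^{-x/\rho}}{(x+1)^M}\big[\tfrac1\rho(x+1)+M-1\big]$. Each user $i$ has a threshold $\tau_i\in[0,\infty]$ and truncated SINR $\bar\gamma_{i,m}=\gamma_{i,m}\mathbf 1\{\gamma_{i,m}\ge\tau_i\}$. The ergodic sum rate is $R(\vec\tau) = \mathbb{E}\big[\sum_{m=1}^M\log(1+\max_{1\le i\le n}\bar\gamma_{i,m})\big]$. The feedback probability is $p_i = \Pr\{\gamma_{i,1}\ge\tau_i\}=1-F(\tau_i)$, and $R$ is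 regarded as a function $R(\vec p)$ via $\tau_i=F^{-1}(1-p_i)$ (with $F^{-1}(1)=+\infty$). A threshold vector is homogeneous if all thresholds are equal. Majorization: $\vec x$ majorizes $\vec y$ if the partial sums of the decreasingly ordered coordinates of $\vec x$ dominate those of $\vec y$ and the total sums are equal; $\varphi$ is Schur-concave if $\vec x$ majorizing $\vec y$ implies $\varphi(\vec x)\le\varphi(\vec y)$. *)

theory Defs
  imports "HOL-Probability.Probability"
begin

text \<open>Users are indexed by i < n, beams by m < M (0-based).
  The channel coefficients X(i,k) are i.i.d. unit-power circularly symmetric
  complex Gaussian: density exp(-|z|^2)/pi w.r.t. Lebesgue measure on the complex plane.\<close>

definition cgauss :: "complex measure" where
  "cgauss = density lborel (\<lambda>z. ennreal (exp (- (cmod z)\<^sup>2) / pi))"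

definition channel_model :: "nat \<Rightarrow> nat \<Rightarrow> (nat \<times> nat \<Rightarrow> complex) measure" where
  "channel_model n M = PiM ({..<n} \<times> {..<M}) (\<lambda>_. cgauss)"

definition sinr :: "nat \<Rightarrow> real \<Rightarrow> (nat \<times> nat \<Rightarrow> complex) \<Rightarrow> nat \<Rightarrow> nat \<Rightarrow> real" where
  "sinr M \<rho> X i m = (cmod (X (i, m)))\<^sup>2 / (1 / \<rho> + (\<Sum>k\<in>{..<M} - {m}. (cmod (X (i, k)))\<^sup>2))"

definition trunc_sinr :: "nat \<Rightarrow> real \<Rightarrow> (nat \<Rightarrow> ereal) \<Rightarrow> (nat \<times> nat \<Rightarrow> complex) \<Rightarrow> nat \<Rightarrow> nat \<Rightarrow> real" where
  "trunc_sinr M \<rho> \<tau> X i m = (if \<tau> i \<le> ereal (sinr M \<rho> X i m) then sinr M \<rho> X i m else 0)"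

definition sum_rate :: "nat \<Rightarrow> nat \<Rightarrow> real \<Rightarrow> (nat \<Rightarrow> ereal) \<Rightarrow> real" where
  "sum_rate n M \<rho> \<tau> = integral\<^sup>L (channel_model n M)
     (\<lambda>X. \<Sum>m<M. ln (1 + Max ((\<lambda>i. trunc_sinr M \<rho> \<tau> X i m) ` {..<n})))"

text \<open>Feedback probability Pr{gamma_(i,1) >= tau_i} (beam 1 is index 0).\<close>
definition feedback_prob :: "nat \<Rightarrow> nat \<Rightarrow> real \<Rightarrow> (nat \<Rightarrow> ereal) \<Rightarrow> nat \<Rightarrow> real" where
  "feedback_prob n M \<rho> \<tau> i =
     measure (channel_model n M) {X \<in> space (channel_model n M). \<tau> i \<le> ereal (sinr M \<rho> X i 0)}"

text \<open>Marginal CDF F of each SINR (as given in the system model).\<close>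
definition sinr_cdf :: "nat \<Rightarrow> real \<Rightarrow> real \<Rightarrow> real" where
  "sinr_cdf M \<rho> x = 1 - exp (- x / \<rho>) / (x + 1) ^ (M - 1)"

text \<open>tau = F^{-1}(1 - p), with F^{-1}(1) = +infinity.\<close>
definition tau_of_prob :: "nat \<Rightarrow> real \<Rightarrow> real \<Rightarrow> ereal" where
  "tau_of_prob M \<rho> p = (if p = 0 then PInfty
      else ereal (THE x. 0 \<le> x \<and> sinr_cdf M \<rho> x = 1 - p))"

definition sum_rate_p :: "nat \<Rightarrow> nat \<Rightarrow> real \<Rightarrow> (nat \<Rightarrow> real) \<Rightarrow> real" where
  "sum_rate_p n M \<rho> p = sum_rate n M \<rho> (\<lambda>i. tau_of_prob M \<rho> (p i))"

definition dec_sorted :: "nat \<Rightarrow> (nat \<Rightarrow> real) \<Rightarrow> real list" where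
  "dec_sorted n x = rev (sort (map x [0..<n]))"

definition majorizes :: "nat \<Rightarrow> (nat \<Rightarrow> real) \<Rightarrow> (nat \<Rightarrow> real) \<Rightarrow> bool" where
  "majorizes n x y \<longleftrightarrow>
     (\<forall>k\<le>n. sum_list (take k (dec_sorted n y)) \<le> sum_list (take k (dec_sorted n x)))
     \<and> (\<Sum>i<n. x i) = (\<Sum>i<n. y i)"

definition schur_concave_on :: "nat \<Rightarrow> (nat \<Rightarrow> real) set \<Rightarrow> ((nat \<Rightarrow> real) \<Rightarrow> real) \<Rightarrow> bool" where
  "schur_concave_on n D \<phi> \<longleftrightarrow>
     (\<forall>x\<in>D. \<forall>y\<in>D. majorizes n x y \<longrightarrow> \<phi> x \<le> \<phi> y)"

end

theory Submission
  imports Defs "HOL-Real_Asymp.Real_Asymp"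
begin

text \<open>
  Put \<open>u = ln (1 + x)\<close> and let \<open>F u\<close> be the SINR distribution function in this variable. By
  independence of the users, the rate of one beam is the integral over \<open>u \<ge> 0\<close> of
  \<open>1 - (\<Prod>i<n. max (F u) (1 - p i))\<close>. For \<open>M > 1\<close> the function \<open>F\<close> is concave in \<open>u\<close>.

  By a chain of two-coordinate transfers it suffices to replace the values \<open>a \<le> b\<close> of two of the
  \<open>1 - p i\<close> by closer ones \<open>a' \<le> b'\<close> with the same sum. With
  \<open>d v = max v a * max v b - max v a' * max v b'\<close> and \<open>G\<close> the product of the other factors, the rate
  grows by \<open>\<integral> G u * d (F u) du = \<integral> (G u / F' u) * d (F u) * F' u du\<close>. Here \<open>d\<close> changes sign
  once, from negative to positive, and the weight \<open>G / F'\<close> is nondecreasing, so this is at least a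
  nonnegative multiple of \<open>\<integral> d (F u) * F' u du = \<integral>\<^sub>0\<^sup>1 d v dv\<close>, which is nonnegative by an explicit
  computation.
\<close>

subsection \<open>Majorization by transfers\<close>

text \<open>Induction on the number of coordinates where \<open>x\<close> and \<open>y\<close>
  disagree. Each step moves mass from a surplus coordinate to a deficit one so that at least one of
  the two becomes correct, while \<open>x\<close> stays decreasing and its partial sums still
  dominate those of \<open>y\<close>.\<close>

lemma majorization_transfer_chain:
  fixes x y :: "nat \<Rightarrow> real" and \<Phi> :: "(nat \<Rightarrow> real) \<Rightarrow> real"
  assumes transfer: "\<And>z i j a b. \<lbrakk>\<forall>k<n. z k \<in> {lo..hi}; i < n; j < n; i \<noteq> j;
      z j \<le> b; b \<le> a; a \<le> z i; a + b = z i + z j\<rbrakk> \<Longrightarrow> \<Phi> z \<le> \<Phi> (z(i := a, j := b))"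
    and cong: "\<And>z z'. (\<And>k. k < n \<Longrightarrow> z k = z' k) \<Longrightarrow> \<Phi> z = \<Phi> z'"
    and "\<forall>k<n. x k \<in> {lo..hi}"
    and "\<And>i j. i \<le> j \<Longrightarrow> j < n \<Longrightarrow> x j \<le> x i"
    and y_dec: "\<And>i j. i \<le> j \<Longrightarrow> j < n \<Longrightarrow> y j \<le> y i"
    and "\<And>k. k \<le> n \<Longrightarrow> (\<Sum>i<k. y i) \<le> (\<Sum>i<k. x i)"
    and "(\<Sum>i<n. x i) = (\<Sum>i<n. y i)"
  shows "\<Phi> x \<le> \<Phi> y"
  using assms(3,4,6,7)
proof (induction "card {i. i < n \<and> x i \<noteq> y i}" arbitrary: x rule: less_induct)
  case less
  note box = less.prems(1) and x_dec = less.prems(2) and psum = less.prems(3) and tot = less.prems(4)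
  show ?case
  proof (cases "\<exists>k<n. x k < y k")
    case False
    hence le: "y i \<le> x i" if "i < n" for i using that by force
    have "x i = y i" if "i < n" for i
    proof (rule ccontr)
      assume "x i \<noteq> y i"
      hence "y i < x i" using le[OF that] by simp
      hence "(\<Sum>i<n. y i) < (\<Sum>i<n. x i)"
        using le that by (intro sum_strict_mono_ex1) auto
      thus False using tot by simp
    qed
    thus ?thesis using cong[of x y] by simp
  next
    case True
    \<comment> \<open>The transfer goes from the last surplus \<open>j\<close> before the first
      deficit \<open>k\<close>. All entries strictly between them then agree with \<open>y\<close>,
      which keeps the new vector decreasing.\<close>
    define k where "k = (LEAST k. k < n \<and> x k < y k)"
    have k: "k < n" "x k < y k" using LeastI_ex[OF True] by (auto simp: k_def)
    have k_min: "y i \<le> x i" if "i < k" for i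
      using not_less_Least[of i "\<lambda>k. k < n \<and> x k < y k"] that k by (auto simp: k_def)
    have "\<exists>j<k. y j < x j"
    proof (rule ccontr)
      assume "\<not> (\<exists>j<k. y j < x j)"
      hence "(\<Sum>i<k. x i) \<le> (\<Sum>i<k. y i)" by (intro sum_mono) (meson lessThan_iff not_less)
      hence "(\<Sum>i<Suc k. x i) < (\<Sum>i<Suc k. y i)" using k by simp
      thus False using psum[of "Suc k"] k by simp
    qed
    then obtain j0 where j0: "j0 < k \<and> y j0 < x j0" by blast
    define j where "j = (GREATEST j. j < k \<and> y j < x j)"
    have j: "j < k" "y j < x j"
      using GreatestI_nat[of "\<lambda>j. j < k \<and> y j < x j" j0 k] j0 by (auto simp: j_def)
    have between: "x i = y i" if "j < i" "i < k" for i
    proof -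
      have "\<not> (i < k \<and> y i < x i)"
        using Greatest_le_nat[of "\<lambda>j. j < k \<and> y j < x j" i k] that by (fastforce simp: j_def)
      thus ?thesis using k_min[of i] that by auto
    qed
    \<comment> \<open>The largest amount for which neither coordinate overshoots its target: one
      disagreement disappears, and \<open>x' j \<ge> y j \<ge> y k \<ge> x' k\<close>.\<close>
    define \<delta> where "\<delta> = min (x j - y j) (y k - x k)"
    have \<delta>: "\<delta> > 0" "\<delta> \<le> x j - y j" "\<delta> \<le> y k - x k" using j k by (auto simp: \<delta>_def)
    define x' where "x' = x(j := x j - \<delta>, k := x k + \<delta>)"
    have x'j: "x' j = x j - \<delta>" and x'k: "x' k = x k + \<delta>" using j by (auto simp: x'_def)
    have x'o: "x' i = x i" if "i \<noteq> j" "i \<noteq> k" for i using that by (simp add: x'_def)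
    have yjk: "y k \<le> y j" using y_dec[of j k] j k by simp
    have "\<Phi> x \<le> \<Phi> x'"
      unfolding x'_def using j k \<delta> yjk box by (intro transfer) auto
    also have "\<Phi> x' \<le> \<Phi> y"
    proof (rule less.hyps)
      have "j \<in> {i. i < n \<and> x i \<noteq> y i}" "k \<in> {i. i < n \<and> x i \<noteq> y i}" using j k by auto
      moreover have "x' j = y j \<or> x' k = y k" using x'j x'k by (auto simp: \<delta>_def min_def)
      moreover have "{i. i < n \<and> x' i \<noteq> y i} \<subseteq> {i. i < n \<and> x i \<noteq> y i}"
        using x'o calculation by (metis (no_types, lifting) mem_Collect_eq subsetI)
      ultimately show "card {i. i < n \<and> x' i \<noteq> y i} < card {i. i < n \<and> x i \<noteq> y i}"
        by (intro psubset_card_mono) auto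
    next
      show "\<forall>i<n. x' i \<in> {lo..hi}"
      proof (intro allI impI)
        fix i assume "i < n"
        have "x j \<in> {lo..hi}" "x k \<in> {lo..hi}" "x i \<in> {lo..hi}" using box j k \<open>i < n\<close> by auto
        thus "x' i \<in> {lo..hi}"
          using \<delta> yjk x'o[of i] x'j x'k by (cases "i = j"; cases "i = k") auto
      qed
    next
      fix i l assume il: "i \<le> l" "l < n"
      have xil: "x l \<le> x i" using x_dec il by auto
      show "x' l \<le> x' i"
      proof (cases "i = l")
        case False
        hence "i < l" using il by simp
        \<comment> \<open>The order can only be endangered when \<open>i = j\<close> or
          \<open>l = k\<close>. Entries between \<open>j\<close> and \<open>k\<close> are then
          compared through \<open>y\<close>, entries outside through \<open>x j\<close> or
          \<open>x k\<close>.\<close>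
        consider "i = j" "l = k" | "i = j" "l < k" | "i = j" "k < l" | "i = k"
          | "i \<noteq> j" "i \<noteq> k" "l = j" | "i < j" "l = k" | "j < i" "i < k" "l = k" | "k < i" "l = k"
          | "i \<noteq> j" "i \<noteq> k" "l \<noteq> j" "l \<noteq> k"
          by linarith
        thus ?thesis
        proof cases
          case 1 thus ?thesis using x'j x'k \<delta> yjk by auto
        next
          case 2
          have "x l = y l" using between 2 \<open>i < l\<close> by auto
          moreover have "y l \<le> y j" using y_dec[of j l] 2 \<open>i < l\<close> il by auto
          moreover have "x' l = x l" using x'o 2 \<open>i < l\<close> by auto
          ultimately show ?thesis using 2 x'j \<delta> by auto
        next
          case 3
          have "x l \<le> x k" using x_dec[of k l] 3 il by auto
          moreover have "x' l = x l" using x'o 3 j by auto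
          ultimately show ?thesis using 3 x'j \<delta> yjk by auto
        next
          case 4
          have "x' l = x l" using x'o 4 j \<open>i < l\<close> by auto
          thus ?thesis using 4 x'k \<delta> xil by auto
        next
          case 5 thus ?thesis using x'o[of i] x'j \<delta> xil by auto
        next
          case 6
          have "x j \<le> x i" using x_dec[of i j] 6 j k by auto
          moreover have "x' i = x i" using x'o 6 j by auto
          ultimately show ?thesis using 6 x'k \<delta> yjk by auto
        next
          case 7
          have "x i = y i" using between 7 by auto
          moreover have "y k \<le> y i" using y_dec[of i k] 7 k by auto
          moreover have "x' i = x i" using x'o 7 by auto
          ultimately show ?thesis using 7 x'k \<delta> by auto
        next
          case 8 thus ?thesis using \<open>i < l\<close> by auto
        next
          case 9 thus ?thesis using x'o xil by auto
        qed
      qed auto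
    next
      have eq: "x' i = x i + (if i = k then \<delta> else 0) - (if i = j then \<delta> else 0)" for i
        using x'o x'j x'k j by auto
      have sum_x': "(\<Sum>i<l. x' i) = (\<Sum>i<l. x i) + (if k < l then \<delta> else 0) - (if j < l then \<delta> else 0)" for l
        by (simp add: eq sum.distrib sum_subtractf sum.delta)
      show "(\<Sum>i<n. x' i) = (\<Sum>i<n. y i)" using sum_x' j k tot by simp
      fix l assume l: "l \<le> n"
      show "(\<Sum>i<l. y i) \<le> (\<Sum>i<l. x' i)"
      \<comment> \<open>The partial sums change only for \<open>j < l \<le> k\<close>, where they
        drop by \<open>\<delta>\<close>. In that range no summand of \<open>x'\<close> is below that
        of \<open>y\<close>, since no deficit occurs before \<open>k\<close>.\<close>
      proof (cases "j < l \<and> l \<le> k")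
        case True
        have "y i \<le> x' i" if "i < l" for i
          using that True k_min[of i] x'o[of i] x'j \<delta> by (cases "i = j") auto
        thus ?thesis by (intro sum_mono) auto
      next
        case False
        thus ?thesis using psum[OF l] sum_x'[of l] j by auto
      qed
    qed
    finally show ?thesis .
  qed
qed

section \<open>Decreasing rearrangements and a criterion for Schur-concavity\<close>

lemma dec_sorted_props:
  shows length_dec_sorted: "length (dec_sorted n x) = n"
    and mset_dec_sorted: "mset (dec_sorted n x) = mset (map x [0..<n])"
    and dec_sorted_antimono: "\<And>i j. i \<le> j \<Longrightarrow> j < n \<Longrightarrow> dec_sorted n x ! j \<le> dec_sorted n x ! i"
proof -
  show l: "length (dec_sorted n x) = n" and "mset (dec_sorted n x) = mset (map x [0..<n])"
    by (simp_all add: dec_sorted_def)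
  fix i j assume ij: "i \<le> j" "j < n"
  have "sorted (rev (dec_sorted n x))" by (simp add: dec_sorted_def)
  thus "dec_sorted n x ! j \<le> dec_sorted n x ! i"
    using ij l by (auto simp: sorted_rev_iff_nth_mono)
qed

lemma sum_list_take_eq_sum_nth: "k \<le> length xs \<Longrightarrow> sum_list (take k xs) = (\<Sum>i<k. xs ! i)"
  for xs :: "real list"
  by (simp add: sum_list_sum_nth atLeast0LessThan)

text \<open>Symmetry reduces the claim to decreasing rearrangements, where the transfer chain
  applies. Symmetry in terms of multisets of the first \<open>n\<close> values also yields the
  congruence assumption of the chain.\<close>

lemma schur_concave_onI:
  fixes \<Phi> :: "(nat \<Rightarrow> real) \<Rightarrow> real"
  assumes transfer: "\<And>z i j a b. \<lbrakk>\<forall>k<n. z k \<in> {lo..hi}; i < n; j < n; i \<noteq> j;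
      z j \<le> b; b \<le> a; a \<le> z i; a + b = z i + z j\<rbrakk> \<Longrightarrow> \<Phi> z \<le> \<Phi> (z(i := a, j := b))"
    and sym: "\<And>z z'. mset (map z [0..<n]) = mset (map z' [0..<n]) \<Longrightarrow> \<Phi> z = \<Phi> z'"
  shows "schur_concave_on n {p. \<forall>i<n. lo \<le> p i \<and> p i \<le> hi} \<Phi>"
  unfolding schur_concave_on_def
proof (intro ballI impI)
  fix x y assume x: "x \<in> {p. \<forall>i<n. lo \<le> p i \<and> p i \<le> hi}" and maj: "majorizes n x y"
  define sx sy where "sx = (\<lambda>i. dec_sorted n x ! i)" and "sy = (\<lambda>i. dec_sorted n y ! i)"
  have map_nth': "map (\<lambda>i. dec_sorted n z ! i) [0..<n] = dec_sorted n z" for z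
    by (metis length_dec_sorted map_nth)
  have sums: "(\<Sum>i<k. dec_sorted n z ! i) = sum_list (take k (dec_sorted n z))" if "k \<le> n" for k z
    using that by (simp add: sum_list_take_eq_sum_nth length_dec_sorted)
  have total: "(\<Sum>i<n. dec_sorted n z ! i) = (\<Sum>i<n. z i)" for z
  proof -
    have "sum_list (dec_sorted n z) = sum_list (map z [0..<n])"
      by (metis mset_dec_sorted sum_mset_sum_list)
    thus ?thesis using sums[of n z] 
      by (simp add: length_dec_sorted interv_sum_list_conv_sum_set_nat atLeast0LessThan)
  qed
  have "\<Phi> x = \<Phi> sx" "\<Phi> y = \<Phi> sy"
    by (auto intro!: sym simp: sx_def sy_def map_nth' mset_dec_sorted simp del: mset_map)
  moreover have "\<Phi> sx \<le> \<Phi> sy"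
  proof (rule majorization_transfer_chain[where \<Phi> = \<Phi> and x = sx and y = sy and n = n and lo = lo and hi = hi])
    show "\<forall>k<n. sx k \<in> {lo..hi}"
    proof (intro allI impI)
      fix k assume "k < n"
      hence "sx k \<in> set (dec_sorted n x)" by (auto simp: sx_def length_dec_sorted)
      also have "set (dec_sorted n x) = x ` {..<n}"
        by (auto simp: dec_sorted_def)
      finally show "sx k \<in> {lo..hi}" using x by auto
    qed
  next
    fix z z' :: "nat \<Rightarrow> real" assume "\<And>k. k < n \<Longrightarrow> z k = z' k"
    thus "\<Phi> z = \<Phi> z'" by (intro sym arg_cong[of _ _ mset]) auto
  qed (use transfer maj in \<open>auto simp: sx_def sy_def majorizes_def sums total intro: dec_sorted_antimono\<close>)
  ultimately show "\<Phi> x \<le> \<Phi> y" by simp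
qed

text \<open>The \<open>k\<close> largest entries average at least the overall mean. For
  \<open>k < n\<close>: if \<open>d ! k\<close> is at least the mean, so are all entries before it;
  otherwise the last \<open>n - k\<close> entries sum to at most \<open>n - k\<close> times the
  mean.\<close>

lemma majorizes_mean:
  fixes x :: "nat \<Rightarrow> real"
  assumes "n > 0"
  shows "majorizes n x (\<lambda>_. (\<Sum>i<n. x i) / n)"
proof -
  define \<mu> where "\<mu> = (\<Sum>i<n. x i) / n"
  define d where "d = dec_sorted n x"
  have total: "(\<Sum>i<n. d ! i) = n * \<mu>"
  proof -
    have "sum_list d = sum_list (map x [0..<n])"
      unfolding d_def by (metis mset_dec_sorted sum_mset_sum_list)
    thus ?thesis using assms sum_list_take_eq_sum_nth[of n d]
      by (simp add: d_def length_dec_sorted interv_sum_list_conv_sum_set_nat atLeast0LessThan \<mu>_def)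
  qed
  have "sum_list (take k (dec_sorted n (\<lambda>_. \<mu>))) \<le> sum_list (take k d)" if k: "k \<le> n" for k
  proof -
    have "mset (dec_sorted n (\<lambda>_. \<mu>)) = mset (replicate n \<mu>)"
      by (simp add: mset_dec_sorted map_replicate_const)
    hence "set (dec_sorted n (\<lambda>_. \<mu>)) \<subseteq> {\<mu>}" by (metis mset_eq_setD set_replicate_conv_if empty_subsetI subset_refl)
    hence "dec_sorted n (\<lambda>_. \<mu>) = replicate n \<mu>"
      by (metis length_dec_sorted replicate_eqI singletonD subsetD)
    hence "sum_list (take k (dec_sorted n (\<lambda>_. \<mu>))) = k * \<mu>"
      using k by (simp add: sum_list_replicate)
    also have "k * \<mu> \<le> (\<Sum>i<k. d ! i)"
    proof (cases "k < n \<and> d ! k < \<mu>")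
      case True
      have "(\<Sum>i=k..<n. d ! i) \<le> (\<Sum>i=k..<n. \<mu>)"
        using True dec_sorted_antimono[of k _ n x] by (intro sum_mono) (fastforce simp: d_def)
      moreover have "(\<Sum>i<n. d ! i) = (\<Sum>i<k. d ! i) + (\<Sum>i=k..<n. d ! i)"
        using sum.atLeastLessThan_concat[of 0 k n "(!) d"] k by (simp add: atLeast0LessThan)
      ultimately show ?thesis using total k by (simp add: of_nat_diff algebra_simps)
    next
      case False
      show ?thesis
      proof (cases "k = n")
        case True thus ?thesis using total by simp
      next
        case False
        hence "\<mu> \<le> d ! k" "k < n" using k \<open>\<not> (k < n \<and> d ! k < \<mu>)\<close> by auto
        hence "(\<Sum>i<k. \<mu>) \<le> (\<Sum>i<k. d ! i)"
          using dec_sorted_antimono[of _ k n x] unfolding d_def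
          by (intro sum_mono) (meson lessThan_iff less_imp_le order_trans)
        thus ?thesis by simp
      qed
    qed
    also have "\<dots> = sum_list (take k d)"
      using k by (simp add: sum_list_take_eq_sum_nth d_def length_dec_sorted)
    finally show ?thesis .
  qed
  thus ?thesis using assms by (simp add: majorizes_def d_def flip: \<mu>_def) (simp add: \<mu>_def)
qed

subsection \<open>The weighted spread integral\<close>

text \<open>The integrand is \<open>a * b\<close> on \<open>{0..a}\<close>, \<open>v * b\<close> on
  \<open>{a..b}\<close> and \<open>v * v\<close> on \<open>{b..1}\<close>.\<close>

lemma has_integral_max_mult_max:
  fixes a b :: real
  assumes "0 \<le> a" "a \<le> b" "b \<le> 1"
  shows "((\<lambda>v. max v a * max v b) has_integral (a\<^sup>2 * b / 2 + b ^ 3 / 6 + 1 / 3)) {0..1}"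
proof -
  have 1: "((\<lambda>v. max v a * max v b) has_integral (a * b * a - a * b * 0)) {0..a}"
  proof (rule has_integral_eq[rotated])
    show "((\<lambda>v. a * b) has_integral (a * b * a - a * b * 0)) {0..a}"
      by (rule fundamental_theorem_of_calculus)
         (use assms in \<open>auto intro!: derivative_eq_intros simp flip: has_real_derivative_iff_has_vector_derivative\<close>)
  qed (use assms in auto)
  have 2: "((\<lambda>v. max v a * max v b) has_integral (b\<^sup>2 * b / 2 - a\<^sup>2 * b / 2)) {a..b}"
  proof (rule has_integral_eq[rotated])
    show "((\<lambda>v. v * b) has_integral (b\<^sup>2 * b / 2 - a\<^sup>2 * b / 2)) {a..b}"
      by (rule fundamental_theorem_of_calculus)
         (use assms in \<open>auto intro!: derivative_eq_intros simp flip: has_real_derivative_iff_has_vector_derivative\<close>)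
  qed (use assms in auto)
  have 3: "((\<lambda>v. max v a * max v b) has_integral (1 ^ 3 / 3 - b ^ 3 / 3)) {b..1}"
  proof (rule has_integral_eq[rotated])
    show "((\<lambda>v. v * v) has_integral (1 ^ 3 / 3 - b ^ 3 / 3)) {b..1}"
      by (rule fundamental_theorem_of_calculus)
         (use assms in \<open>auto intro!: derivative_eq_intros simp: power2_eq_square simp flip: has_real_derivative_iff_has_vector_derivative\<close>)
  qed (use assms in auto)
  show ?thesis
    using has_integral_combine[OF _ _ has_integral_combine[OF _ _ 1 2] 3] assms
    by (simp add: power2_eq_square power3_eq_cube algebra_simps)
qed

text \<open>In the half-sum s and the half-difference h the expression is 2/3 (s^3 + h^3). The
  half-sums agree, and the cube grows with the half-difference.\<close>

lemma spread_cubic_le: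
  fixes a b a' b' :: real
  assumes "a \<le> a'" "a' \<le> b'" "a + b = a' + b'"
  shows "a'\<^sup>2 * b' / 2 + b' ^ 3 / 6 \<le> a\<^sup>2 * b / 2 + b ^ 3 / 6"
proof -
  have eq: "x\<^sup>2 * y / 2 + y ^ 3 / 6 = 2 / 3 * (((x + y) / 2) ^ 3 + ((y - x) / 2) ^ 3)" for x y :: real
    by (simp add: power2_eq_square power3_eq_cube field_simps)
  have "((b' - a') / 2) ^ 3 \<le> ((b - a) / 2) ^ 3"
    using assms by (intro power_mono) auto
  thus ?thesis unfolding eq using assms by simp
qed

lemma spread_mult_le:
  fixes a b a' b' :: real
  assumes "a \<le> a'" "a' \<le> b'" "a + b = a' + b'"
  shows "a * b \<le> a' * b'"
proof -
  have "a' * b' - a * b = (a' - a) * (b' - a)"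
    using assms(3) by algebra
  moreover have "0 \<le> (a' - a) * (b' - a)" using assms by (intro mult_nonneg_nonneg) auto
  ultimately show ?thesis by linarith
qed

text \<open>The crossing point \<open>a' * b' / b\<close> solves \<open>v * b = a' * b'\<close>. It
  lies between \<open>a\<close> and \<open>a'\<close>, where the two products are exactly
  \<open>v * b\<close> and \<open>a' * b'\<close>.\<close>

lemma max_mult_max_single_crossing:
  fixes a b a' b' v :: real
  assumes "0 \<le> a" "a \<le> a'" "a' \<le> b'" "b' \<le> b" "a + b = a' + b'" "0 < b"
  shows "v \<le> a' * b' / b \<Longrightarrow> max v a * max v b \<le> max v a' * max v b'"
    and "a' * b' / b \<le> v \<Longrightarrow> max v a' * max v b' \<le> max v a * max v b"
proof -
  have ab: "a * b \<le> a' * b'" using spread_mult_le assms by blast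
  have ca: "a \<le> a' * b' / b" using ab assms by (simp add: field_simps)
  have ca': "a' * b' / b \<le> a'" using assms by (simp add: field_simps mult_left_mono)
  {
    assume v: "v \<le> a' * b' / b"
    hence "v * b \<le> a' * b'" using assms by (simp add: field_simps)
    hence "max v a * b \<le> a' * b'" using ab by (simp add: max_def)
    thus "max v a * max v b \<le> max v a' * max v b'" using v ca' assms by (simp add: max_def)
  next
    assume v: "a' * b' / b \<le> v"
    hence vb: "a' * b' \<le> v * b" using assms by (simp add: field_simps)
    have va: "a \<le> v" using ca v by linarith
    show "max v a' * max v b' \<le> max v a * max v b"
    proof (cases "v \<le> a'")
      case True thus ?thesis using va vb assms by (simp add: max_def)
    next
      case False
      have "v * max v b' \<le> v * max v b" using va assms by (intro mult_left_mono) auto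
      thus ?thesis using False va by (simp add: max_def)
    qed
  }
qed

text \<open>A comparison of Chebyshev type: freezing the nondecreasing weight \<open>G / f\<close>
  at the sign change of \<open>d\<close> can only lower the integral.\<close>

lemma concave_cdf_spread_integral_nonneg:
  fixes F f G :: "real \<Rightarrow> real"
  defines "d a b a' b' \<equiv> \<lambda>v::real. max v a * max v b - max v a' * max v b'"
  assumes F_deriv: "\<And>u. 0 \<le> u \<Longrightarrow> (F has_real_derivative f u) (at u)"
    and f_pos: "\<And>u. 0 \<le> u \<Longrightarrow> 0 < f u"
    and f_dec: "\<And>u v. 0 \<le> u \<Longrightarrow> u \<le> v \<Longrightarrow> f v \<le> f u"
    and F_0: "F 0 = 0" and F_lim: "(F \<longlongrightarrow> 1) at_top"
    and f_cont: "continuous_on {0..} f"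
    and f_borel [measurable]: "f \<in> borel_measurable borel"
    and F_borel [measurable]: "F \<in> borel_measurable borel"
    and G_inc: "\<And>u v. 0 \<le> u \<Longrightarrow> u \<le> v \<Longrightarrow> G u \<le> G v" and G_nonneg: "\<And>u. 0 \<le> u \<Longrightarrow> 0 \<le> G u"
    and ab: "0 \<le> a" "a < a'" "a' \<le> b'" "b' < b" "b \<le> 1" "a + b = a' + b'"
    and int: "set_integrable lborel {0..} (\<lambda>u. G u * d a b a' b' (F u))"
  shows "0 \<le> (LINT u:{0..}|lborel. G u * d a b a' b' (F u))"
proof -
  define D where "D = d a b a' b'"
  have F_mono: "F u \<le> F v" if "0 \<le> u" "u \<le> v" for u v
  proof (rule DERIV_nonneg_imp_nondecreasing[OF that(2)])
    fix x assume "u \<le> x" "x \<le> v"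
    hence "0 \<le> x" using that by simp
    thus "\<exists>y. (F has_real_derivative y) (at x) \<and> 0 \<le> y"
      using F_deriv f_pos less_imp_le by blast
  qed
  have F_ge: "0 \<le> F u" if "0 \<le> u" for u using F_mono[of 0 u] that F_0 by simp
  have F_le: "F u \<le> 1" if "0 \<le> u" for u
  proof (rule tendsto_lowerbound[OF F_lim])
    show "\<forall>\<^sub>F x in at_top. F u \<le> F x"
      using eventually_ge_at_top[of u] by eventually_elim (use F_mono that in auto)
  qed auto
  have b: "0 < b" using ab by auto
  have D_cont: "continuous_on A D" for A unfolding D_def d_def by (intro continuous_intros)
  have [measurable]: "D \<in> borel_measurable borel"
    using D_cont by (rule borel_measurable_continuous_onI)

  \<comment> \<open>A primitive of \<open>D\<close> started left of 0, hence differentiable from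
    both sides at 0 and 1. The chain rule with \<open>F\<close> needs this at the value 0, and the
    limit \<open>F u\<close> to 1 needs continuity at 1.\<close>
  define P where "P = (\<lambda>v. integral {-1..v} D)"
  have P_deriv: "(P has_real_derivative D v) (at v)" if "-1 < v" "v < 2" for v
  proof -
    have "(P has_real_derivative D v) (at v within {-1..2})"
      unfolding P_def using that D_cont by (intro integral_has_real_derivative) auto
    thus ?thesis using that at_within_Icc_at[of "-1" v 2] by simp
  qed
  have "(D has_integral (a\<^sup>2 * b / 2 + b ^ 3 / 6 + 1 / 3) - (a'\<^sup>2 * b' / 2 + b' ^ 3 / 6 + 1 / 3)) {0..1}"
    unfolding D_def d_def using ab by (intro has_integral_diff has_integral_max_mult_max) auto
  moreover have "(D has_integral (P 1 - P 0)) {0..1}"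
  proof (rule fundamental_theorem_of_calculus)
    fix v :: real assume "v \<in> {0..1}"
    thus "(P has_vector_derivative D v) (at v within {0..1})"
      using has_field_derivative_at_within[OF P_deriv[of v]]
      by (simp flip: has_real_derivative_iff_has_vector_derivative)
  qed simp
  ultimately have "P 1 - P 0 = (a\<^sup>2 * b / 2 + b ^ 3 / 6 + 1 / 3) - (a'\<^sup>2 * b' / 2 + b' ^ 3 / 6 + 1 / 3)"
    by (rule has_integral_unique[symmetric])
  hence P01: "P 0 \<le> P 1"
    using spread_cubic_le[of a a' b' b] ab by linarith

  \<comment> \<open>The total mass of \<open>f\<close> is \<open>1 - F 0\<close>. As
    \<open>D\<close> is bounded by 1 on \<open>{0..1}\<close>, \<open>f\<close> then dominates the
    integrand after substitution.\<close>
  have f_int: "set_integrable lborel {0..} f"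
  proof -
    have "(\<integral>\<^sup>+u. ennreal (f u) * indicator {0..} u \<partial>lborel) = 1 - F 0"
      by (rule nn_integral_FTC_atLeast) (use F_deriv f_pos F_lim in \<open>auto intro: less_imp_le\<close>)
    hence "(\<integral>\<^sup>+u. ennreal (indicator {0..} u * f u) \<partial>lborel) < \<infinity>"
      by (subst (asm) nn_integral_cong[where v = "\<lambda>u. ennreal (indicator {0..} u * f u)"])
         (auto simp: indicator_def F_0)
    thus ?thesis unfolding set_integrable_def
      by (intro integrableI_nonneg) (auto simp: indicator_def intro: less_imp_le[OF f_pos])
  qed
  have D_bound: "\<bar>D v\<bar> \<le> 1" if "0 \<le> v" "v \<le> 1" for v
  proof -
    have "0 \<le> max v x * max v y \<and> max v x * max v y \<le> 1" if "x \<le> 1" "y \<le> 1" for x y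
      using that \<open>0 \<le> v\<close> \<open>v \<le> 1\<close> by (auto intro!: mult_le_one mult_nonneg_nonneg)
    hence "0 \<le> max v a * max v b \<and> max v a * max v b \<le> 1" "0 \<le> max v a' * max v b' \<and> max v a' * max v b' \<le> 1"
      using ab by auto
    thus ?thesis unfolding D_def d_def by linarith
  qed
  have Df_int: "set_integrable lborel {0..} (\<lambda>u. D (F u) * f u)"
    using f_int unfolding set_integrable_def
  proof (rule Bochner_Integration.integrable_bound)
    show "AE u in lborel. norm (indicator {0..} u *\<^sub>R (D (F u) * f u)) \<le> norm (indicator {0..} u *\<^sub>R f u)"
      using D_bound F_ge F_le f_pos
      by (intro AE_I2) (auto simp: indicator_def abs_mult intro!: mult_left_le_one_le)
  qed measurable

  \<comment> \<open>The substitution \<open>v = F u\<close> on the half-line: the fundamental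
    theorem on \<open>{0..T}\<close>, then \<open>T\<close> to infinity on both sides.\<close>
  have "((\<lambda>T. \<integral>u. indicator {..T} u *\<^sub>R (indicator {0..} u *\<^sub>R (D (F u) * f u)) \<partial>lborel)
      \<longlongrightarrow> (LINT u:{0..}|lborel. D (F u) * f u)) at_top"
    using Df_int unfolding set_integrable_def set_lebesgue_integral_def
    by (intro tendsto_integral_at_top) auto
  moreover have "\<forall>\<^sub>F T in at_top. (\<integral>u. indicator {..T} u *\<^sub>R (indicator {0..} u *\<^sub>R (D (F u) * f u)) \<partial>lborel)
      = P (F T) - P (F 0)"
    using eventually_ge_at_top[of "0::real"]
  proof eventually_elim
    case (elim T)
    have "continuous_on {0..T} F"
      using F_deriv by (auto intro!: continuous_at_imp_continuous_on DERIV_isCont)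
    hence cont: "continuous_on {0..T} (\<lambda>u. D (F u) * f u)"
      by (intro continuous_on_mult continuous_on_compose2[OF D_cont[of UNIV]]
            continuous_on_subset[OF f_cont]) auto
    have der: "((\<lambda>u. P (F u)) has_real_derivative D (F u) * f u) (at u within {0..T})"
      if "u \<in> {0..T}" for u
      using that F_deriv[of u] P_deriv[of "F u"] F_ge[of u] F_le[of u]
      by (intro has_field_derivative_at_within[OF DERIV_chain2[where f = P and g = F]]) auto
    have "(\<integral>u. indicator {0..T} u *\<^sub>R (D (F u) * f u) \<partial>lborel) = P (F T) - P (F 0)"
      by (rule integral_FTC_Icc[OF elim _ cont])
         (use der in \<open>auto simp: has_real_derivative_iff_has_vector_derivative\<close>)
    also have "(\<integral>u. indicator {0..T} u *\<^sub>R (D (F u) * f u) \<partial>lborel)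
      = (\<integral>u. indicator {..T} u *\<^sub>R (indicator {0..} u *\<^sub>R (D (F u) * f u)) \<partial>lborel)"
      by (intro Bochner_Integration.integral_cong) (auto simp: indicator_def)
    finally show ?case by simp
  qed
  ultimately have "((\<lambda>T. P (F T) - P (F 0)) \<longlongrightarrow> (LINT u:{0..}|lborel. D (F u) * f u)) at_top"
    by (rule Lim_transform_eventually)
  moreover have "((\<lambda>T. P (F T) - P (F 0)) \<longlongrightarrow> P 1 - P (F 0)) at_top"
    using DERIV_isCont[OF P_deriv[of 1]] F_lim
    by (intro tendsto_intros isCont_tendsto_compose[where g = P]) auto
  ultimately have "(LINT u:{0..}|lborel. D (F u) * f u) = P 1 - P (F 0)"
    using tendsto_unique trivial_limit_at_top_linorder by blast
  hence Df_nonneg: "0 \<le> (LINT u:{0..}|lborel. D (F u) * f u)" using P01 F_0 by simp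

  \<comment> \<open>the sign change of \<open>D\<close>\<close>
  define c where "c = a' * b' / b"
  have c: "0 \<le> c" "c < 1"
  proof -
    have "a' * b' \<le> 1 * b'" using ab by (intro mult_right_mono) auto
    also have "\<dots> < b" using ab by simp
    finally show "c < 1" using b by (simp add: c_def)
  qed (use ab b in \<open>simp add: c_def\<close>)
  have "\<forall>\<^sub>F u in at_top. c < F u \<and> 0 \<le> u"
    using order_tendstoD(1)[OF F_lim c(2)] eventually_ge_at_top[of 0] by (rule eventually_conj)
  then obtain s where s: "c < F s" "0 \<le> s" by (auto dest!: eventually_happens)
  \<comment> \<open>Since \<open>c < 1\<close>, which rests on the strict \<open>b' < b\<close>, the
    limit 1 of \<open>F\<close> and continuity give a finite point at the level of the sign
    change.\<close>
  have "\<exists>t\<ge>0. t \<le> s \<and> F t = c"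
    using s c F_0 F_deriv
    by (intro IVT') (auto intro!: continuous_at_imp_continuous_on DERIV_isCont)
  then obtain t where t: "0 \<le> t" "F t = c" by blast

  have "G t / f t * (D (F u) * f u) \<le> G u * D (F u)" if u: "0 \<le> u" for u
  proof -
    \<comment> \<open>The comparison cleared of denominators. Left of \<open>t\<close> both factors
      are nonpositive, right of it both are nonnegative.\<close>
    have "0 \<le> (G u * f t - G t * f u) * D (F u)"
    proof (cases "u \<le> t")
      case True
      have "G u * f t \<le> G t * f u"
        using True u t G_inc[of u t] f_dec[of u t] G_nonneg[of t] f_pos[of t]
        by (intro mult_mono) auto
      moreover have "D (F u) \<le> 0"
        using max_mult_max_single_crossing(1)[of a a' b' b "F u"] F_mono[of u t] True u t ab b
        by (auto simp: D_def d_def c_def)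
      ultimately show ?thesis by (intro mult_nonpos_nonpos) auto
    next
      case False
      have "G t * f u \<le> G u * f t"
        using False u t G_inc[of t u] f_dec[of t u] G_nonneg[of u] f_pos[of u]
        by (intro mult_mono) auto
      moreover have "0 \<le> D (F u)"
        using max_mult_max_single_crossing(2)[of a a' b' b "F u"] F_mono[of t u] False u t ab b
        by (auto simp: D_def d_def c_def)
      ultimately show ?thesis by (intro mult_nonneg_nonneg) auto
    qed
    thus ?thesis using f_pos[OF t(1)] by (simp add: field_simps)
  qed
  hence "(LINT u:{0..}|lborel. G t / f t * (D (F u) * f u)) \<le> (LINT u:{0..}|lborel. G u * D (F u))"
    using int Df_int by (intro set_integral_mono set_integrable_mult_right) (auto simp: D_def)
  moreover have "(LINT u:{0..}|lborel. G t / f t * (D (F u) * f u)) = G t / f t * (LINT u:{0..}|lborel. D (F u) * f u)"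
    by (rule set_integral_mult_right)
  moreover have "0 \<le> G t / f t * (LINT u:{0..}|lborel. D (F u) * f u)"
    using Df_nonneg G_nonneg[OF t(1)] f_pos[OF t(1)] by (intro mult_nonneg_nonneg) auto
  ultimately show ?thesis by (simp add: D_def)
qed

subsection \<open>Distribution of the SINR\<close>

text \<open>Area is linear in the squared radii, which is what makes the squared modulus of a
  Gaussian exponentially distributed.\<close>

lemma emeasure_lborel_annulus:
  assumes "0 \<le> t" "t \<le> s"
  shows "emeasure lborel {z::complex. t \<le> (cmod z)\<^sup>2 \<and> (cmod z)\<^sup>2 \<le> s} = ennreal (pi * (s - t))"
proof -
  have eq: "{z::complex. t \<le> (cmod z)\<^sup>2 \<and> (cmod z)\<^sup>2 \<le> s} = cball 0 (sqrt s) - ball 0 (sqrt t)"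
  proof -
    have "sqrt t \<le> cmod z \<longleftrightarrow> t \<le> (cmod z)\<^sup>2" "cmod z \<le> sqrt s \<longleftrightarrow> (cmod z)\<^sup>2 \<le> s" for z
      by (metis abs_norm_cancel real_sqrt_abs real_sqrt_le_iff)+
    thus ?thesis by (auto simp flip: not_le)
  qed
  have "emeasure lborel (cball (0::complex) (sqrt s) - ball 0 (sqrt t))
      = emeasure lborel (cball (0::complex) (sqrt s)) - emeasure lborel (ball (0::complex) (sqrt t))"
    using assms subset_ball[OF real_sqrt_le_mono[OF assms(2)], of "0::complex"] ball_subset_cball
    by (intro emeasure_Diff) (auto simp: emeasure_ball simp del: real_sqrt_le_iff)
  also have "\<dots> = ennreal (pi * s) - ennreal (pi * t)"
    using assms by (simp add: emeasure_ball emeasure_cball unit_ball_vol_2 del: ennreal_minus)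
  also have "\<dots> = ennreal (pi * (s - t))"
    using assms by (subst ennreal_minus) (auto simp: right_diff_distrib)
  finally show ?thesis by (simp add: eq)
qed

text \<open>Writing \<open>exp (- b * r)\<close> as the integral of \<open>b * exp (- b * s)\<close> over \<open>s \<ge> r\<close> reduces this
  Gaussian integral to areas of annuli, which avoids polar coordinates.\<close>

lemma nn_integral_cgauss_exp_tail:
  fixes a t :: real
  assumes "0 \<le> a" "0 \<le> t"
  shows "(\<integral>\<^sup>+z. ennreal (exp (- a * (cmod z)\<^sup>2)) * indicator {z. t \<le> (cmod z)\<^sup>2} z \<partial>cgauss)
    = ennreal (exp (- (a + 1) * t) / (a + 1))"
proof -
  \<comment> \<open>The joint decay rate of weight and Gaussian density. With \<open>a = 0\<close>
    the result is the exponential tail of \<open>(cmod z)\<^sup>2\<close>, with \<open>t = 0\<close>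
    its Laplace transform; the law of the SINR uses both.\<close>
  define b where "b = a + 1"
  have b: "b > 0" using assms by (simp add: b_def)
  have exp_tail: "(\<integral>\<^sup>+s. ennreal (b / pi * exp (- b * s)) * indicator {r..} s \<partial>lborel)
      = ennreal (exp (- b * r) / pi)" for r
  proof -
    have "(\<integral>\<^sup>+s. ennreal (b / pi * exp (- b * s)) * indicator {r..} s \<partial>lborel)
        = ennreal (0 - (- exp (- b * r) / pi))"
    proof (rule nn_integral_FTC_atLeast)
      show "((\<lambda>s. - exp (- b * s) / pi) \<longlongrightarrow> 0) at_top" using b by real_asymp
    qed (use b in \<open>auto intro!: derivative_eq_intros simp: field_simps\<close>)
    thus ?thesis by simp
  qed
  have "(\<integral>\<^sup>+z. ennreal (exp (- a * (cmod z)\<^sup>2)) * indicator {z. t \<le> (cmod z)\<^sup>2} z \<partial>cgauss)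
      = (\<integral>\<^sup>+z. ennreal (exp (- (cmod z)\<^sup>2) / pi) *
          (ennreal (exp (- a * (cmod z)\<^sup>2)) * indicator {z. t \<le> (cmod z)\<^sup>2} z) \<partial>lborel)"
    unfolding cgauss_def by (rule nn_integral_density) auto
  also have "\<dots> = (\<integral>\<^sup>+z. (\<integral>\<^sup>+s. ennreal (b / pi * exp (- b * s)) *
      indicator {z. t \<le> (cmod z)\<^sup>2 \<and> (cmod z)\<^sup>2 \<le> s} z \<partial>lborel) \<partial>lborel)"
  proof (rule nn_integral_cong)
    fix z :: complex
    have "(\<integral>\<^sup>+s. ennreal (b / pi * exp (- b * s)) *
        indicator {z. t \<le> (cmod z)\<^sup>2 \<and> (cmod z)\<^sup>2 \<le> s} z \<partial>lborel)
      = (\<integral>\<^sup>+s. ennreal (b / pi * exp (- b * s)) * indicator {(cmod z)\<^sup>2..} s *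
          indicator {z. t \<le> (cmod z)\<^sup>2} z \<partial>lborel)"
      by (intro nn_integral_cong) (auto simp: indicator_def)
    also have "\<dots> = ennreal (exp (- b * (cmod z)\<^sup>2) / pi) * indicator {z. t \<le> (cmod z)\<^sup>2} z"
      by (subst nn_integral_multc) (auto simp only: exp_tail, measurable)
    also have "exp (- b * (cmod z)\<^sup>2) = exp (- (cmod z)\<^sup>2) * exp (- a * (cmod z)\<^sup>2)"
      by (simp add: b_def algebra_simps flip: exp_add)
    finally show "ennreal (exp (- (cmod z)\<^sup>2) / pi) *
          (ennreal (exp (- a * (cmod z)\<^sup>2)) * indicator {z. t \<le> (cmod z)\<^sup>2} z) =
        (\<integral>\<^sup>+s. ennreal (b / pi * exp (- b * s)) *
          indicator {z. t \<le> (cmod z)\<^sup>2 \<and> (cmod z)\<^sup>2 \<le> s} z \<partial>lborel)"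
      by (simp add: ennreal_mult' flip: mult.assoc) (simp add: mult_ac flip: ennreal_mult')
  qed
  \<comment> \<open>Tonelli: for fixed \<open>s\<close> the inner integral becomes the area of an
    annulus, which is empty for \<open>s < t\<close>.\<close>
  also have "\<dots> = (\<integral>\<^sup>+s. (\<integral>\<^sup>+z. ennreal (b / pi * exp (- b * s)) *
      indicator {z. t \<le> (cmod z)\<^sup>2 \<and> (cmod z)\<^sup>2 \<le> s} z \<partial>lborel) \<partial>lborel)"
    by (rule lborel_pair.Fubini'[symmetric]) measurable
  also have "\<dots> = (\<integral>\<^sup>+s. ennreal (b * exp (- b * s) * (s - t)) * indicator {t..} s \<partial>lborel)"
  proof (rule nn_integral_cong)
    fix s :: real
    have "(\<integral>\<^sup>+z. ennreal (b / pi * exp (- b * s)) *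
        indicator {z. t \<le> (cmod z)\<^sup>2 \<and> (cmod z)\<^sup>2 \<le> s} z \<partial>lborel)
      = ennreal (b / pi * exp (- b * s)) * emeasure lborel {z::complex. t \<le> (cmod z)\<^sup>2 \<and> (cmod z)\<^sup>2 \<le> s}"
      by (subst nn_integral_cmult_indicator) auto
    also have "\<dots> = ennreal (b * exp (- b * s) * (s - t)) * indicator {t..} s"
    proof (cases "t \<le> s")
      case True
      thus ?thesis using b assms by (simp add: emeasure_lborel_annulus flip: ennreal_mult')
    next
      case False
      hence "{z::complex. t \<le> (cmod z)\<^sup>2 \<and> (cmod z)\<^sup>2 \<le> s} = {}" by auto
      thus ?thesis using False by (simp only: emeasure_empty) simp
    qed
    finally show "(\<integral>\<^sup>+z. ennreal (b / pi * exp (- b * s)) *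
        indicator {z. t \<le> (cmod z)\<^sup>2 \<and> (cmod z)\<^sup>2 \<le> s} z \<partial>lborel)
      = ennreal (b * exp (- b * s) * (s - t)) * indicator {t..} s" .
  qed
  also have "\<dots> = ennreal (0 - (- (t - t + 1 / b) * exp (- b * t)))"
  proof (rule nn_integral_FTC_atLeast[where F = "\<lambda>s. - (s - t + 1 / b) * exp (- b * s)"])
    show "((\<lambda>s. - (s - t + 1 / b) * exp (- b * s)) \<longlongrightarrow> 0) at_top" using b by real_asymp
  qed (use b in \<open>auto intro!: derivative_eq_intros simp: field_simps\<close>)
  finally show ?thesis by (simp add: b_def)
qed

section \<open>The channel as a product probability space and the law of the SINR\<close>

lemma sets_cgauss [measurable_cong, simp]: "sets cgauss = sets borel"
  by (simp add: cgauss_def)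

lemma space_cgauss [simp]: "space cgauss = UNIV"
  by (simp add: cgauss_def)

interpretation cgauss: prob_space cgauss
proof
  have "(\<integral>\<^sup>+z. ennreal (exp (- 0 * (cmod z)\<^sup>2)) * indicator {z. 0 \<le> (cmod z)\<^sup>2} z \<partial>cgauss) = 1"
    by (subst nn_integral_cgauss_exp_tail) auto
  thus "emeasure cgauss (space cgauss) = 1" by simp
qed

interpretation cgauss_prod: product_prob_space "\<lambda>_. cgauss" I for I :: "(nat \<times> nat) set"
  by standard

interpretation channel: prob_space "channel_model n M" for n M
  unfolding channel_model_def by (intro prob_space_PiM cgauss.prob_space_axioms)

lemma sets_channel_model [measurable_cong]:
  "sets (channel_model n M) = sets (PiM ({..<n} \<times> {..<M}) (\<lambda>_. cgauss))"
  by (simp add: channel_model_def)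

text \<open>The index set is left open to cover both the whole channel and the single row of user
  \<open>i\<close>, which the independence proof composes with.\<close>

lemma sinr_measurable_PiM:
  assumes "{i} \<times> {..<M} \<subseteq> J" "m < M"
  shows "(\<lambda>X. sinr M \<rho> X i m) \<in> borel_measurable (PiM J (\<lambda>_. cgauss))"
proof -
  have [measurable]: "(\<lambda>X. X (i, k)) \<in> PiM J (\<lambda>_. cgauss) \<rightarrow>\<^sub>M borel" if "k < M" for k
    using measurable_component_singleton[of "(i, k)" J "\<lambda>_. cgauss"] assms that
      measurable_cong_sets[OF refl sets_cgauss] by blast
  show ?thesis unfolding sinr_def
    using assms(2) by (intro borel_measurable_divide borel_measurable_add borel_measurable_sum
        borel_measurable_power borel_measurable_norm borel_measurable_const) auto
qed

lemma sinr_measurable [measurable]: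
  assumes "i < n" "m < M"
  shows "(\<lambda>X. sinr M \<rho> X i m) \<in> borel_measurable (channel_model n M)"
  unfolding channel_model_def using assms by (intro sinr_measurable_PiM) auto

lemma sinr_nonneg: "\<rho> > 0 \<Longrightarrow> 0 \<le> sinr M \<rho> X i m"
  unfolding sinr_def by (intro divide_nonneg_nonneg add_nonneg_nonneg sum_nonneg) auto

text \<open>Integrate out \<open>X (i, m)\<close> first. Given the interference, the event says that
  an exponential variable is at least \<open>x * D\<close>, which has probability
  \<open>exp (- (x * D))\<close>. This splits into \<open>exp (- x / \<rho>)\<close> and one factor
  per interfering beam, whose expectation is the Laplace transform
  \<open>1 / (x + 1)\<close>.\<close>

lemma emeasure_sinr_ge:
  assumes "i < n" "m < M" "\<rho> > 0" "0 \<le> x"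
  shows "emeasure (channel_model n M) {X \<in> space (channel_model n M). x \<le> sinr M \<rho> X i m}
    = ennreal (exp (- x / \<rho>) / (x + 1) ^ (M - 1))"
proof -
  define J where "J = {..<n} \<times> {..<M} - {(i, m)}"
  \<comment> \<open>Coordinates of other users get the factor 1, so that the product runs over all
    of \<open>J\<close> and the product formula for integrals applies.\<close>
  define g where "g = (\<lambda>(j :: nat \<times> nat) (z :: complex). if fst j = i then ennreal (exp (- x * (cmod z)\<^sup>2)) else 1)"
  have J: "finite J" "(i, m) \<notin> J" "{..<n} \<times> {..<M} = insert (i, m) J"
    using assms by (auto simp: J_def)
  have row: "{j \<in> J. fst j = i} = Pair i ` ({..<M} - {m})"
    using assms by (auto simp: J_def)
  have row_prod: "(\<Prod>j\<in>J. if fst j = i then h j else 1) = (\<Prod>k\<in>{..<M} - {m}. h (i, k))"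
    for h :: "nat \<times> nat \<Rightarrow> ennreal"
  proof -
    have "(\<Prod>j\<in>J. if fst j = i then h j else 1) = (\<Prod>j\<in>{j \<in> J. fst j = i}. h j)"
      using J(1) by (simp add: prod.inter_filter)
    thus ?thesis by (simp add: row prod.reindex inj_on_def)
  qed
  have [measurable]: "(\<lambda>X. sinr M \<rho> X i m) \<in> borel_measurable (PiM (insert (i, m) J) (\<lambda>_. cgauss))"
    using sinr_measurable[OF assms(1,2)] J(3) by (simp add: channel_model_def)
  have "emeasure (channel_model n M) {X \<in> space (channel_model n M). x \<le> sinr M \<rho> X i m}
      = (\<integral>\<^sup>+X. indicator {X. x \<le> sinr M \<rho> X i m} X \<partial>channel_model n M)"
    using assms by (subst nn_integral_indicator[symmetric], measurable)
      (auto intro!: nn_integral_cong simp: indicator_def simp del: nn_integral_indicator)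
  also have "\<dots> = (\<integral>\<^sup>+X. (\<integral>\<^sup>+z. indicator {X. x \<le> sinr M \<rho> X i m} (X((i, m) := z)) \<partial>cgauss) \<partial>PiM J (\<lambda>_. cgauss))"
    unfolding channel_model_def J(3) using J(1,2)
    by (intro cgauss_prod.product_nn_integral_insert) measurable
  also have "\<dots> = (\<integral>\<^sup>+X. ennreal (exp (- x / \<rho>)) * (\<Prod>j\<in>J. g j (X j)) \<partial>PiM J (\<lambda>_. cgauss))"
  proof (rule nn_integral_cong)
    fix X :: "nat \<times> nat \<Rightarrow> complex"
    define D where "D = 1 / \<rho> + (\<Sum>k\<in>{..<M} - {m}. (cmod (X (i, k)))\<^sup>2)"
    have D: "D > 0" unfolding D_def using assms by (intro add_pos_nonneg sum_nonneg) auto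
    have "(\<Sum>k\<in>{..<M} - {m}. (cmod ((X((i, m) := z)) (i, k)))\<^sup>2)
        = (\<Sum>k\<in>{..<M} - {m}. (cmod (X (i, k)))\<^sup>2)" for z
      by (intro sum.cong) auto
    hence sinr_upd: "sinr M \<rho> (X((i, m) := z)) i m = (cmod z)\<^sup>2 / D" for z
      by (simp add: sinr_def D_def)
    have "(\<integral>\<^sup>+z. indicator {X. x \<le> sinr M \<rho> X i m} (X((i, m) := z)) \<partial>cgauss)
      = (\<integral>\<^sup>+z. ennreal (exp (- 0 * (cmod z)\<^sup>2)) * indicator {z. x * D \<le> (cmod z)\<^sup>2} z \<partial>cgauss)"
      using D by (intro nn_integral_cong) (auto simp: indicator_def sinr_upd pos_le_divide_eq)
    also have "\<dots> = ennreal (exp (- (x * D)))"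
      using D assms by (subst nn_integral_cgauss_exp_tail) auto
    also have "exp (- (x * D)) = exp (- x / \<rho>) * (\<Prod>k\<in>{..<M} - {m}. exp (- x * (cmod (X (i, k)))\<^sup>2))"
    proof -
      have "- (x * D) = - x / \<rho> + (\<Sum>k\<in>{..<M} - {m}. - x * (cmod (X (i, k)))\<^sup>2)"
        by (simp add: D_def algebra_simps sum_distrib_left sum_negf)
      thus ?thesis by (simp only: exp_add exp_sum finite_Diff finite_lessThan)
    qed
    also have "ennreal \<dots> = ennreal (exp (- x / \<rho>)) * (\<Prod>j\<in>J. g j (X j))"
      unfolding g_def row_prod by (simp add: ennreal_mult' prod_ennreal)
    finally show "(\<integral>\<^sup>+z. indicator {X. x \<le> sinr M \<rho> X i m} (X((i, m) := z)) \<partial>cgauss)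
      = ennreal (exp (- x / \<rho>)) * (\<Prod>j\<in>J. g j (X j))" .
  qed
  also have "\<dots> = ennreal (exp (- x / \<rho>)) * (\<integral>\<^sup>+X. (\<Prod>j\<in>J. g j (X j)) \<partial>PiM J (\<lambda>_. cgauss))"
    by (intro nn_integral_cmult borel_measurable_prod_ennreal) (auto simp: g_def)
  also have "(\<integral>\<^sup>+X. (\<Prod>j\<in>J. g j (X j)) \<partial>PiM J (\<lambda>_. cgauss)) = (\<Prod>j\<in>J. integral\<^sup>N cgauss (g j))"
    using J(1) by (intro cgauss_prod.product_nn_integral_prod) (auto simp: g_def)
  also have "\<dots> = (\<Prod>j\<in>J. if fst j = i then ennreal (1 / (x + 1)) else 1)"
  proof (intro prod.cong refl)
    fix j assume "j \<in> J"
    have "integral\<^sup>N cgauss (g j) = (\<integral>\<^sup>+z. ennreal (exp (- x * (cmod z)\<^sup>2)) * indicator {z. 0 \<le> (cmod z)\<^sup>2} z \<partial>cgauss)"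
      if "fst j = i"
      using that by (intro nn_integral_cong) (auto simp: g_def)
    thus "integral\<^sup>N cgauss (g j) = (if fst j = i then ennreal (1 / (x + 1)) else 1)"
      using nn_integral_cgauss_exp_tail[of x 0] assms cgauss.emeasure_space_1 by (auto simp: g_def)
  qed
  also have "\<dots> = ennreal ((1 / (x + 1)) ^ (M - 1))"
    unfolding row_prod using assms by (simp add: ennreal_power)
  finally show ?thesis using assms by (simp add: power_one_over divide_simps flip: ennreal_mult')
qed

text \<open>The coefficients are independent because their law is a product measure. Grouping them
  by the disjoint rows of the users keeps independence, and the SINR of user \<open>i\<close> is a
  function of row \<open>i\<close>.\<close>

lemma indep_vars_sinr:
  assumes "m < M" "n > 0"
  shows "prob_space.indep_vars (channel_model n M) (\<lambda>_. borel) (\<lambda>i X. sinr M \<rho> X i m) {..<n}"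
proof -
  define J where "J = {..<n} \<times> {..<M}"
  have J: "finite J" "J \<noteq> {}" using assms by (auto simp: J_def)
  \<comment> \<open>Criterion for independence: the joint law is the product of the marginals.
    Restriction to \<open>J\<close> is the identity on the space of the product.\<close>
  have "distr (channel_model n M) (PiM J (\<lambda>_. cgauss)) (\<lambda>X. \<lambda>j\<in>J. X j)
      = distr (channel_model n M) (channel_model n M) (\<lambda>X. X)"
    by (intro distr_cong)
       (auto simp: channel_model_def J_def space_PiM PiE_def extensional_restrict)
  also have "\<dots> = PiM J (\<lambda>_. cgauss)" by (simp add: distr_id channel_model_def J_def)
  also have "\<dots> = PiM J (\<lambda>j. distr (channel_model n M) cgauss (\<lambda>X. X j))"
    unfolding channel_model_def J_def[symmetric]
    by (intro PiM_cong refl distr_PiM_component[symmetric] cgauss.prob_space_axioms J)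
  finally have "channel.indep_vars n M (\<lambda>_. cgauss) (\<lambda>j X. X j) J"
    using J by (subst channel.indep_vars_iff_distr_eq_PiM')
      (auto simp: channel_model_def J_def)
  hence "channel.indep_vars n M (\<lambda>i. PiM ({i} \<times> {..<M}) (\<lambda>_. cgauss))
      (\<lambda>i X. restrict (\<lambda>j. X j) ({i} \<times> {..<M})) {..<n}"
    by (rule channel.indep_vars_restrict) (auto simp: J_def disjoint_family_on_def)
  hence "channel.indep_vars n M (\<lambda>_. borel)
      (\<lambda>i X. sinr M \<rho> (restrict (\<lambda>j. X j) ({i} \<times> {..<M})) i m) {..<n}"
    by (rule channel.indep_vars_compose2) (use assms in \<open>auto intro!: sinr_measurable_PiM\<close>)
  moreover have "sinr M \<rho> (restrict (\<lambda>j. X j) ({i} \<times> {..<M})) i m = sinr M \<rho> X i m" for X i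
    using assms by (simp add: sinr_def)
  ultimately show ?thesis by simp
qed

section \<open>The tail function of the SINR and the inverse of its distribution function\<close>

text \<open>Infinity is a separate case because \<open>real_of_ereal\<close> sends it to 0, where
  the formula has the value 1 instead of 0.\<close>

definition sinr_tail :: "nat \<Rightarrow> real \<Rightarrow> ereal \<Rightarrow> real" where
  "sinr_tail M \<rho> t = (if t = \<infinity> then 0
     else exp (- real_of_ereal t / \<rho>) / (real_of_ereal t + 1) ^ (M - 1))"

lemma sinr_tail_infinity [simp]: "sinr_tail M \<rho> \<infinity> = 0"
  by (simp add: sinr_tail_def)

lemma sinr_tail_ereal: "sinr_tail M \<rho> (ereal x) = 1 - sinr_cdf M \<rho> x"
  by (simp add: sinr_tail_def sinr_cdf_def)

lemma prob_sinr_ge: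
  assumes "i < n" "m < M" "\<rho> > 0" "0 \<le> t"
  shows "measure (channel_model n M) {X \<in> space (channel_model n M). t \<le> ereal (sinr M \<rho> X i m)}
    = sinr_tail M \<rho> t"
proof (cases t)
  case (real x)
  thus ?thesis using emeasure_sinr_ge[of i n m M \<rho> x] assms
    by (simp add: sinr_tail_def measure_def)
qed (use assms in auto)

lemma feedback_prob_eq_sinr_tail:
  assumes "i < n" "M > 0" "\<rho> > 0" "0 \<le> \<tau> i"
  shows "feedback_prob n M \<rho> \<tau> i = sinr_tail M \<rho> (\<tau> i)"
  unfolding feedback_prob_def using assms by (intro prob_sinr_ge) auto

lemma sinr_cdf_strict_mono:
  assumes "0 \<le> x" "x < y" "\<rho> > 0"
  shows "sinr_cdf M \<rho> x < sinr_cdf M \<rho> y"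
proof -
  have "exp (- y / \<rho>) / (y + 1) ^ (M - 1) < exp (- x / \<rho>) / (x + 1) ^ (M - 1)"
    using assms by (intro frac_less) (auto intro!: power_mono divide_strict_right_mono)
  thus ?thesis by (simp add: sinr_cdf_def)
qed

lemma sinr_cdf_0 [simp]: "sinr_cdf M \<rho> 0 = 0"
  by (simp add: sinr_cdf_def)

lemma sinr_cdf_lt_1: "0 \<le> x \<Longrightarrow> sinr_cdf M \<rho> x < 1"
  by (simp add: sinr_cdf_def)

lemma sinr_cdf_nonneg: "0 \<le> x \<Longrightarrow> \<rho> > 0 \<Longrightarrow> 0 \<le> sinr_cdf M \<rho> x"
  using sinr_cdf_strict_mono[of 0 x \<rho> M] by (cases "x = 0") auto

lemma sinr_cdf_tendsto:
  assumes "\<rho> > 0"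
  shows "(sinr_cdf M \<rho> \<longlongrightarrow> 1) at_top"
proof -
  have "((\<lambda>x. exp (- x / \<rho>) / (x + 1) ^ (M - 1)) \<longlongrightarrow> 0) at_top"
  proof (rule real_tendsto_sandwich)
    show "\<forall>\<^sub>F x in at_top. exp (- x / \<rho>) / (x + 1) ^ (M - 1) \<le> exp (- x / \<rho>)"
      using eventually_ge_at_top[of 0]
      by eventually_elim (simp add: divide_le_eq mult_le_cancel_left1 one_le_power)
    show "\<forall>\<^sub>F x in at_top. 0 \<le> exp (- x / \<rho>) / (x + 1) ^ (M - 1)"
      using eventually_ge_at_top[of 0] by eventually_elim simp
    show "((\<lambda>x. exp (- x / \<rho>)) \<longlongrightarrow> 0) at_top" using assms by real_asymp
  qed auto
  from tendsto_diff[OF tendsto_const[of 1] this] show ?thesis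
    by (simp add: sinr_cdf_def[abs_def])
qed

lemma sinr_tail_bounds:
  assumes "0 \<le> t" "\<rho> > 0"
  shows "0 \<le> sinr_tail M \<rho> t" "sinr_tail M \<rho> t \<le> 1"
  using assms sinr_cdf_nonneg[of _ \<rho> M] sinr_cdf_lt_1[of _ M \<rho>]
  by (cases t; force simp: sinr_tail_ereal)+

lemma sinr_tail_antimono:
  assumes "0 \<le> s" "s \<le> t" "\<rho> > 0"
  shows "sinr_tail M \<rho> t \<le> sinr_tail M \<rho> s"
proof (cases t)
  case (real y)
  then obtain x where x: "s = ereal x" using assms by (cases s) auto
  show ?thesis
    using real x assms sinr_cdf_strict_mono[of x y \<rho> M] by (cases "x = y") (auto simp: sinr_tail_ereal)
qed (use assms sinr_tail_bounds in auto)

lemma sinr_tail_max: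
  assumes "0 \<le> s" "0 \<le> t" "\<rho> > 0"
  shows "sinr_tail M \<rho> (max s t) = min (sinr_tail M \<rho> s) (sinr_tail M \<rho> t)"
  using assms sinr_tail_antimono[of s t \<rho> M] sinr_tail_antimono[of t s \<rho> M]
  by (auto simp: max_def min_def)

text \<open>For \<open>p > 0\<close> the distribution function is continuous and strictly increasing
  from 0 towards 1, so \<open>THE\<close> in \<open>tau_of_prob\<close> picks an existing unique
  root. For \<open>p = 0\<close> the threshold is infinite and the tail vanishes.\<close>

lemma sinr_tail_tau_of_prob:
  assumes "0 \<le> p" "p \<le> 1" "\<rho> > 0"
  shows "0 \<le> tau_of_prob M \<rho> p" "sinr_tail M \<rho> (tau_of_prob M \<rho> p) = p"
proof -
  have "0 \<le> tau_of_prob M \<rho> p \<and> sinr_tail M \<rho> (tau_of_prob M \<rho> p) = p"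
  proof (cases "p = 0")
    case False
    hence "1 - p < 1" using assms by simp
    from order_tendstoD(1)[OF sinr_cdf_tendsto[OF assms(3), of M] this]
    have "\<forall>\<^sub>F x in at_top. 1 - p < sinr_cdf M \<rho> x \<and> 0 \<le> x"
      using eventually_ge_at_top[of 0] by (rule eventually_conj)
    then obtain s where s: "1 - p < sinr_cdf M \<rho> s" "0 \<le> s" by (auto dest!: eventually_happens)
    have "\<exists>x\<ge>0. x \<le> s \<and> sinr_cdf M \<rho> x = 1 - p"
      using s assms by (intro IVT') (auto intro!: continuous_intros simp: sinr_cdf_def)
    hence "\<exists>!x. 0 \<le> x \<and> sinr_cdf M \<rho> x = 1 - p"
      using sinr_cdf_strict_mono[OF _ _ assms(3), of _ _ M] by (metis linorder_neq_iff)
    from theI'[OF this] show ?thesis using False by (simp add: tau_of_prob_def sinr_tail_ereal)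
  qed (simp add: tau_of_prob_def)
  thus "0 \<le> tau_of_prob M \<rho> p" "sinr_tail M \<rho> (tau_of_prob M \<rho> p) = p" by auto
qed

subsection \<open>The rate of a beam as a function of the feedback probabilities\<close>

definition log_cdf :: "nat \<Rightarrow> real \<Rightarrow> real \<Rightarrow> real" where
  "log_cdf M \<rho> u = sinr_cdf M \<rho> (exp u - 1)"

text \<open>The derivative of \<open>log_cdf\<close>, factored as survival probability times hazard
  rate; this form makes its sign and its own derivative easy to read off.\<close>

definition log_pdf :: "nat \<Rightarrow> real \<Rightarrow> real \<Rightarrow> real" where
  "log_pdf M \<rho> u = (1 - log_cdf M \<rho> u) * (exp u / \<rho> + real (M - 1))"

lemma log_cdf_eq: "log_cdf M \<rho> u = 1 - exp (- (exp u - 1) / \<rho> - real (M - 1) * u)"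
  by (simp add: log_cdf_def sinr_cdf_def exp_diff exp_of_nat_mult)

lemma log_cdf_deriv: "\<rho> > 0 \<Longrightarrow> (log_cdf M \<rho> has_real_derivative log_pdf M \<rho> u) (at u)"
  unfolding log_pdf_def log_cdf_eq[abs_def]
  by (auto intro!: derivative_eq_intros simp: field_simps)

lemma continuous_on_log_cdf: "continuous_on A (log_cdf M \<rho>)"
  unfolding log_cdf_eq[abs_def] divide_inverse by (intro continuous_intros)

lemma continuous_on_log_pdf: "continuous_on A (log_pdf M \<rho>)"
  unfolding log_pdf_def log_cdf_eq[abs_def] divide_inverse by (intro continuous_intros)

lemma log_cdf_borel [measurable]: "log_cdf M \<rho> \<in> borel_measurable borel"
  by (intro borel_measurable_continuous_onI continuous_on_log_cdf)

lemma log_cdf_bounds: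
  assumes "0 \<le> u" "\<rho> > 0"
  shows "0 \<le> log_cdf M \<rho> u" "log_cdf M \<rho> u < 1"
  unfolding log_cdf_def using assms by (intro sinr_cdf_nonneg sinr_cdf_lt_1; simp)+

lemma log_cdf_mono:
  assumes "0 \<le> u" "u \<le> v" "\<rho> > 0"
  shows "log_cdf M \<rho> u \<le> log_cdf M \<rho> v"
  unfolding log_cdf_def
  using assms sinr_cdf_strict_mono[of "exp u - 1" "exp v - 1" \<rho> M] by (cases "u = v") auto

lemma log_cdf_tendsto:
  assumes "\<rho> > 0"
  shows "(log_cdf M \<rho> \<longlongrightarrow> 1) at_top"
proof -
  have "filterlim (\<lambda>u::real. exp u - 1) at_top at_top" by real_asymp
  from filterlim_compose[OF sinr_cdf_tendsto[OF assms] this] show ?thesis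
    by (simp add: log_cdf_def[abs_def])
qed

text \<open>With k = M - 1 the derivative is S (e - (e + k)^2). For k at least 1 it is nonpositive,
  as e <= e + k <= (e + k)^2. With a single beam, k = 0, it would be positive wherever e <
  1.\<close>

lemma log_pdf_antimono:
  assumes "M > 1" "\<rho> > 0" "u \<le> v"
  shows "log_pdf M \<rho> v \<le> log_pdf M \<rho> u"
proof (rule DERIV_nonpos_imp_nonincreasing[OF assms(3)])
  fix x
  define S where "S = 1 - log_cdf M \<rho> x"
  define e where "e = exp x / \<rho>"
  have "(log_pdf M \<rho> has_real_derivative (S * e - log_pdf M \<rho> x * (e + real (M - 1)))) (at x)"
    unfolding log_pdf_def[abs_def] S_def e_def
    using assms(2) by (auto intro!: derivative_eq_intros log_cdf_deriv simp: log_pdf_def)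
  moreover have "S * e - log_pdf M \<rho> x * (e + real (M - 1)) \<le> 0"
  proof -
    have "e \<ge> 0" "real (M - 1) \<ge> 1" "S \<ge> 0" using assms by (auto simp: e_def S_def log_cdf_eq)
    hence "e * 1 \<le> (e + real (M - 1)) * (e + real (M - 1))" by (intro mult_mono) auto
    hence "S * e \<le> S * ((e + real (M - 1)) * (e + real (M - 1)))"
      using \<open>S \<ge> 0\<close> by (intro mult_left_mono) auto
    thus ?thesis by (simp add: log_pdf_def S_def e_def mult.assoc)
  qed
  ultimately show "\<exists>y. (log_pdf M \<rho> has_real_derivative y) (at x) \<and> y \<le> 0" by blast
qed

text \<open>Integral of the tail probabilities of \<open>ln (1 + max\<^sub>i \<gamma>\<^sub>i)\<close>, with \<open>\<gamma>\<^sub>i\<close> the truncated SINRs.\<close>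

definition beam_rate :: "nat \<Rightarrow> nat \<Rightarrow> real \<Rightarrow> (nat \<Rightarrow> real) \<Rightarrow> real" where
  "beam_rate n M \<rho> p = (LINT u:{0..}|lborel. 1 - (\<Prod>i<n. max (log_cdf M \<rho> u) (1 - p i)))"

text \<open>For the upper bound, every factor is at least \<open>log_cdf M \<rho> u\<close>, and
  Bernoulli's inequality bounds the \<open>n\<close>-th power of that value from below.\<close>

lemma beam_rate_integrand_bounds:
  fixes n :: nat and p :: "nat \<Rightarrow> real"
  assumes "\<rho> > 0" "0 \<le> u" "\<forall>i<n. 0 \<le> p i"
  shows "0 \<le> 1 - (\<Prod>i<n. max (log_cdf M \<rho> u) (1 - p i))"
    and "1 - (\<Prod>i<n. max (log_cdf M \<rho> u) (1 - p i)) \<le> n * (1 - log_cdf M \<rho> u)"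
proof -
  have F: "0 \<le> log_cdf M \<rho> u" "log_cdf M \<rho> u < 1" using log_cdf_bounds assms by auto
  have "(\<Prod>i<n. max (log_cdf M \<rho> u) (1 - p i)) \<le> 1"
    using F assms by (intro prod_le_1) auto
  thus "0 \<le> 1 - (\<Prod>i<n. max (log_cdf M \<rho> u) (1 - p i))" by simp
  have "1 + real n * (log_cdf M \<rho> u - 1) \<le> (1 + (log_cdf M \<rho> u - 1)) ^ n"
    using F by (intro Bernoulli_inequality) auto
  also have "\<dots> = (\<Prod>i<n. log_cdf M \<rho> u)" by simp
  also have "\<dots> \<le> (\<Prod>i<n. max (log_cdf M \<rho> u) (1 - p i))"
    using F by (intro prod_mono) auto
  finally show "1 - (\<Prod>i<n. max (log_cdf M \<rho> u) (1 - p i)) \<le> n * (1 - log_cdf M \<rho> u)"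
    by (simp add: algebra_simps)
qed

text \<open>Since \<open>M - 1\<close> is at least 1, the tail \<open>1 - log_cdf M \<rho> u\<close>
  is at most \<open>exp (- u)\<close>, and the linear bound above gives the majorant
  \<open>n * exp (- u)\<close>.\<close>

lemma beam_rate_integrable:
  fixes n :: nat and p :: "nat \<Rightarrow> real"
  assumes "\<rho> > 0" "M > 1" "\<forall>i<n. 0 \<le> p i"
  shows "set_integrable lborel {0..} (\<lambda>u. 1 - (\<Prod>i<n. max (log_cdf M \<rho> u) (1 - p i)))"
proof -
  have "(\<integral>\<^sup>+u. ennreal (exp (- u)) * indicator {0..} u \<partial>lborel) = ennreal (0 - (- exp (- 0)))"
  proof (rule nn_integral_FTC_atLeast[where F = "\<lambda>u. - exp (- u)"])
    show "((\<lambda>u::real. - exp (- u)) \<longlongrightarrow> 0) at_top" by real_asymp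
  qed (auto intro!: derivative_eq_intros)
  hence "(\<integral>\<^sup>+u. ennreal (indicator {0..} u * exp (- u)) \<partial>lborel) < \<infinity>"
    by (subst (asm) nn_integral_cong[where v = "\<lambda>u. ennreal (indicator {0..} u * exp (- u))"])
       (auto simp: indicator_def)
  hence "set_integrable lborel {0..} (\<lambda>u::real. exp (- u))"
    unfolding set_integrable_def by (intro integrableI_nonneg) (auto simp: indicator_def)
  hence "set_integrable lborel {0..} (\<lambda>u. real n * exp (- u))"
    by (intro set_integrable_mult_right) auto
  thus ?thesis unfolding set_integrable_def
  proof (rule Bochner_Integration.integrable_bound)
    have "\<bar>1 - (\<Prod>i<n. max (log_cdf M \<rho> u) (1 - p i))\<bar> \<le> real n * exp (- u)" if u: "0 \<le> u" for u
    proof -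
      have "1 * u \<le> real (M - 1) * u" using u assms by (intro mult_right_mono) auto
      moreover have "0 \<le> (exp u - 1) / \<rho>" using u assms by simp
      ultimately have "1 - log_cdf M \<rho> u \<le> exp (- u)" by (simp add: log_cdf_eq diff_divide_distrib)
      hence "n * (1 - log_cdf M \<rho> u) \<le> n * exp (- u)" by (intro mult_left_mono) auto
      thus ?thesis using beam_rate_integrand_bounds[OF assms(1) u assms(3), of M] by linarith
    qed
    thus "AE u in lborel. norm (indicator {0..} u *\<^sub>R (1 - (\<Prod>i<n. max (log_cdf M \<rho> u) (1 - p i))))
        \<le> norm (indicator {0..} u *\<^sub>R (real n * exp (- u)))"
      by (intro AE_I2) (auto simp: indicator_def)
  qed measurable
qed

lemma nn_integral_beam_rate:
  fixes n :: nat and p :: "nat \<Rightarrow> real"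
  assumes "\<rho> > 0" "M > 1" "\<forall>i<n. 0 \<le> p i"
  shows "(\<integral>\<^sup>+u. ennreal (1 - (\<Prod>i<n. max (log_cdf M \<rho> u) (1 - p i))) * indicator {0<..} u \<partial>lborel)
    = ennreal (beam_rate n M \<rho> p)" and "0 \<le> beam_rate n M \<rho> p"
proof -
  define g where "g = (\<lambda>u. indicator {0..} u *\<^sub>R (1 - (\<Prod>i<n. max (log_cdf M \<rho> u) (1 - p i))))"
  have nonneg: "0 \<le> g u" for u
    using beam_rate_integrand_bounds(1)[OF assms(1) _ assms(3)] by (auto simp: g_def indicator_def)
  have "(\<integral>\<^sup>+u. ennreal (1 - (\<Prod>i<n. max (log_cdf M \<rho> u) (1 - p i))) * indicator {0<..} u \<partial>lborel)
      = (\<integral>\<^sup>+u. ennreal (g u) \<partial>lborel)"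
    \<comment> \<open>The two half-lines differ by the null set \<open>{0}\<close>; the open one is
      the form in which the layer cake formula delivers the integral.\<close>
    by (intro nn_integral_cong_AE eventually_mono[OF AE_lborel_singleton[of "0::real"]])
       (auto simp: g_def indicator_def)
  also have "\<dots> = ennreal (\<integral>u. g u \<partial>lborel)"
    using beam_rate_integrable[OF assms] nonneg
    by (intro nn_integral_eq_integral) (auto simp: set_integrable_def g_def)
  finally show "(\<integral>\<^sup>+u. ennreal (1 - (\<Prod>i<n. max (log_cdf M \<rho> u) (1 - p i))) * indicator {0<..} u \<partial>lborel)
    = ennreal (beam_rate n M \<rho> p)"
    by (simp add: beam_rate_def set_lebesgue_integral_def g_def)
  have "beam_rate n M \<rho> p = (\<integral>u. g u \<partial>lborel)"
    by (simp add: beam_rate_def set_lebesgue_integral_def g_def)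
  thus "0 \<le> beam_rate n M \<rho> p" using nonneg by (simp add: Bochner_Integration.integral_nonneg)
qed

section \<open>From the expected rate to the integral of tail probabilities\<close>

text \<open>\<open>Y x\<close> is the length of \<open>{0<..Y x}\<close>, and Tonelli exchanges
  length and expectation. With nonnegative integrals, integrability of the rate comes out of the
  formula afterwards.\<close>

lemma (in prob_space) nn_integral_layer_cake:
  fixes Y :: "'a \<Rightarrow> real"
  assumes [measurable]: "Y \<in> borel_measurable M"
    and nonneg: "\<And>x. x \<in> space M \<Longrightarrow> 0 \<le> Y x"
  shows "(\<integral>\<^sup>+x. ennreal (Y x) \<partial>M)
    = (\<integral>\<^sup>+u. ennreal (prob {x \<in> space M. u \<le> Y x}) * indicator {0<..} u \<partial>lborel)"
proof -
  interpret pair_sigma_finite M lborel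
    by (intro pair_sigma_finite.intro) (auto intro: sigma_finite_measure_axioms sigma_finite_lborel)
  have "(\<integral>\<^sup>+x. ennreal (Y x) \<partial>M) = (\<integral>\<^sup>+x. (\<integral>\<^sup>+u. indicator {u. 0 < u \<and> u \<le> Y x} u \<partial>lborel) \<partial>M)"
  proof (rule nn_integral_cong)
    fix x assume "x \<in> space M"
    have "{u. 0 < u \<and> u \<le> Y x} = {0<..Y x}" by auto
    thus "ennreal (Y x) = (\<integral>\<^sup>+u. indicator {u. 0 < u \<and> u \<le> Y x} u \<partial>lborel)"
      using nonneg[OF \<open>x \<in> space M\<close>] by simp
  qed
  also have "\<dots> = (\<integral>\<^sup>+u. (\<integral>\<^sup>+x. indicator {u. 0 < u \<and> u \<le> Y x} u \<partial>M) \<partial>lborel)"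
    by (rule Fubini'[symmetric]) measurable
  also have "\<dots> = (\<integral>\<^sup>+u. ennreal (prob {x \<in> space M. u \<le> Y x}) * indicator {0<..} u \<partial>lborel)"
  proof (rule nn_integral_cong)
    fix u :: real
    have "(\<integral>\<^sup>+x. indicator {u. 0 < u \<and> u \<le> Y x} u \<partial>M)
        = (\<integral>\<^sup>+x. indicator {x \<in> space M. u \<le> Y x} x * indicator {0<..} u \<partial>M)"
      by (intro nn_integral_cong) (auto simp: indicator_def)
    also have "\<dots> = emeasure M {x \<in> space M. u \<le> Y x} * indicator {0<..} u"
      by (subst nn_integral_multc) auto
    finally show "(\<integral>\<^sup>+x. indicator {u. 0 < u \<and> u \<le> Y x} u \<partial>M)
        = ennreal (prob {x \<in> space M. u \<le> Y x}) * indicator {0<..} u"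
      by (simp add: emeasure_eq_measure)
  qed
  finally show ?thesis .
qed

lemma trunc_sinr_measurable [measurable]:
  assumes "i < n" "m < M"
  shows "(\<lambda>X. trunc_sinr M \<rho> \<tau> X i m) \<in> borel_measurable (channel_model n M)"
proof -
  note sinr_measurable[OF assms, measurable]
  show ?thesis unfolding trunc_sinr_def by measurable
qed

text \<open>The rate stays below \<open>u\<close> exactly if every SINR stays below the larger of
  its threshold and \<open>x = exp u - 1\<close>. Independence of the users turns this into a
  product, and the distribution function of the SINR carries the maximum of the two levels to the
  maximum of their values.\<close>

lemma prob_log_rate_ge:
  assumes "\<rho> > 0" "m < M" "n > 0" "\<forall>i<n. 0 \<le> \<tau> i" "0 < u"
  shows "measure (channel_model n M) {X \<in> space (channel_model n M).
      u \<le> ln (1 + Max ((\<lambda>i. trunc_sinr M \<rho> \<tau> X i m) ` {..<n}))}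
    = 1 - (\<Prod>i<n. max (log_cdf M \<rho> u) (1 - sinr_tail M \<rho> (\<tau> i)))"
proof -
  let ?P = "channel_model n M"
  define x where "x = exp u - 1"
  define s where "s = (\<lambda>i. max (\<tau> i) (ereal x))"
  have x: "0 < x" using assms by (simp add: x_def)
  define B where "B = {X \<in> space ?P. \<forall>i<n. ereal (sinr M \<rho> X i m) < s i}"
  \<comment> \<open>As \<open>x > 0\<close>, a user below its threshold, whose truncated SINR is 0,
    never reaches the level \<open>x\<close>.\<close>
  have ev: "u \<le> ln (1 + Max ((\<lambda>i. trunc_sinr M \<rho> \<tau> X i m) ` {..<n}))
      \<longleftrightarrow> \<not> (\<forall>i<n. ereal (sinr M \<rho> X i m) < s i)" for X
  proof -
    let ?S = "(\<lambda>i. trunc_sinr M \<rho> \<tau> X i m) ` {..<n}"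
    have S: "finite ?S" "?S \<noteq> {}" using assms by auto
    have "0 \<le> trunc_sinr M \<rho> \<tau> X 0 m" using assms by (auto simp: trunc_sinr_def sinr_nonneg)
    also have "\<dots> \<le> Max ?S" using assms by (intro Max_ge) auto
    finally have "u \<le> ln (1 + Max ?S) \<longleftrightarrow> x \<le> Max ?S" by (auto simp: x_def ln_ge_iff)
    also have "\<dots> \<longleftrightarrow> (\<exists>i<n. x \<le> trunc_sinr M \<rho> \<tau> X i m)" using Max_ge_iff[OF S] by auto
    also have "\<dots> \<longleftrightarrow> \<not> (\<forall>i<n. ereal (sinr M \<rho> X i m) < s i)"
      using x by (auto simp: trunc_sinr_def s_def less_max_iff_disj not_less not_le)
    finally show ?thesis .
  qed
  have meas: "{X \<in> space ?P. ereal (sinr M \<rho> X i m) < s i} \<in> sets ?P" if "i < n" for i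
  proof -
    note sinr_measurable[OF that assms(2), measurable]
    show ?thesis by measurable
  qed
  have B_Int: "B = (\<Inter>i<n. (\<lambda>X. sinr M \<rho> X i m) -` {y. ereal y < s i} \<inter> space ?P)"
    using assms(3) by (auto simp: B_def)
  have "measure ?P B = (\<Prod>i<n. measure ?P ((\<lambda>X. sinr M \<rho> X i m) -` {y. ereal y < s i} \<inter> space ?P))"
    unfolding B_Int using assms by (intro channel.indep_varsD_finite[OF indep_vars_sinr]) auto
  also have "\<dots> = (\<Prod>i<n. max (log_cdf M \<rho> u) (1 - sinr_tail M \<rho> (\<tau> i)))"
  proof (rule prod.cong[OF refl])
    fix i assume "i \<in> {..<n}"
    hence i: "i < n" by simp
    have "(\<lambda>X. sinr M \<rho> X i m) -` {y. ereal y < s i} \<inter> space ?P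
        = space ?P - {X \<in> space ?P. s i \<le> ereal (sinr M \<rho> X i m)}" by auto
    moreover have "{X \<in> space ?P. s i \<le> ereal (sinr M \<rho> X i m)} \<in> sets ?P"
    proof -
      note sinr_measurable[OF i assms(2), measurable]
      show ?thesis by measurable
    qed
    ultimately have "measure ?P ((\<lambda>X. sinr M \<rho> X i m) -` {y. ereal y < s i} \<inter> space ?P)
        = 1 - sinr_tail M \<rho> (s i)"
      using channel.prob_compl prob_sinr_ge[of i n m M \<rho> "s i"] i assms x by (simp add: s_def le_max_iff_disj)
    also have "\<dots> = max (log_cdf M \<rho> u) (1 - sinr_tail M \<rho> (\<tau> i))"
    proof -
      have "sinr_tail M \<rho> (s i) = min (sinr_tail M \<rho> (\<tau> i)) (1 - log_cdf M \<rho> u)"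
        unfolding s_def using assms i x
        by (subst sinr_tail_max) (auto simp: sinr_tail_ereal log_cdf_def x_def)
      thus ?thesis by (auto simp: min_def max_def)
    qed
    finally show "measure ?P ((\<lambda>X. sinr M \<rho> X i m) -` {y. ereal y < s i} \<inter> space ?P)
        = max (log_cdf M \<rho> u) (1 - sinr_tail M \<rho> (\<tau> i))" .
  qed
  finally have "measure ?P B = (\<Prod>i<n. max (log_cdf M \<rho> u) (1 - sinr_tail M \<rho> (\<tau> i)))" .
  moreover have "{X \<in> space ?P. u \<le> ln (1 + Max ((\<lambda>i. trunc_sinr M \<rho> \<tau> X i m) ` {..<n}))} = space ?P - B"
    by (auto simp: ev B_def)
  moreover have "B \<in> sets ?P"
    unfolding B_Int using meas assms(3) by (intro sets.finite_INT) (auto simp: vimage_def Int_def conj_commute)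
  ultimately show ?thesis by (simp add: channel.prob_compl)
qed

text \<open>Every beam has the same expected rate, and expectations add up although the SINRs on
  different beams share coefficients and are dependent.\<close>

lemma sum_rate_eq_beam_rate:
  assumes "\<rho> > 0" "M > 1" "n > 0" "\<forall>i<n. 0 \<le> \<tau> i" "\<forall>i<n. sinr_tail M \<rho> (\<tau> i) = p i"
  shows "sum_rate n M \<rho> \<tau> = M * beam_rate n M \<rho> p"
proof -
  let ?P = "channel_model n M"
  have p_nonneg: "\<forall>i<n. 0 \<le> p i" using assms sinr_tail_bounds by metis
  have "has_bochner_integral ?P (\<lambda>X. ln (1 + Max ((\<lambda>i. trunc_sinr M \<rho> \<tau> X i m) ` {..<n})))
      (beam_rate n M \<rho> p)" if m: "m < M" for m
  proof (rule has_bochner_integral_nn_integral)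
    define Y where "Y = (\<lambda>X. ln (1 + Max ((\<lambda>i. trunc_sinr M \<rho> \<tau> X i m) ` {..<n})))"
    have "(\<lambda>X. Max ((\<lambda>i. trunc_sinr M \<rho> \<tau> X i m) ` {..<n})) \<in> borel_measurable ?P"
      using m by (intro borel_measurable_Max) auto
    thus [measurable]: "Y \<in> borel_measurable ?P" unfolding Y_def by measurable
    have nonneg: "0 \<le> Y X" for X
    proof -
      have "0 \<le> trunc_sinr M \<rho> \<tau> X 0 m" using assms by (auto simp: trunc_sinr_def sinr_nonneg)
      also have "\<dots> \<le> Max ((\<lambda>i. trunc_sinr M \<rho> \<tau> X i m) ` {..<n})"
        using assms by (intro Max_ge) auto
      finally show ?thesis by (simp add: Y_def)
    qed
    show "AE X in ?P. 0 \<le> Y X" using nonneg by simp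
    have "(\<integral>\<^sup>+X. ennreal (Y X) \<partial>?P)
        = (\<integral>\<^sup>+u. ennreal (measure ?P {X \<in> space ?P. u \<le> Y X}) * indicator {0<..} u \<partial>lborel)"
      using nonneg by (intro channel.nn_integral_layer_cake) auto
    also have "\<dots> = (\<integral>\<^sup>+u. ennreal (1 - (\<Prod>i<n. max (log_cdf M \<rho> u) (1 - p i))) * indicator {0<..} u \<partial>lborel)"
    proof (rule nn_integral_cong)
      fix u :: real
      have "measure ?P {X \<in> space ?P. u \<le> Y X} = 1 - (\<Prod>i<n. max (log_cdf M \<rho> u) (1 - p i))" if "0 < u"
        unfolding Y_def using prob_log_rate_ge[OF assms(1) m assms(3,4) that] assms(5) by simp
      thus "ennreal (measure ?P {X \<in> space ?P. u \<le> Y X}) * indicator {0<..} u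
          = ennreal (1 - (\<Prod>i<n. max (log_cdf M \<rho> u) (1 - p i))) * indicator {0<..} u"
        by (auto simp: indicator_def)
    qed
    also have "\<dots> = ennreal (beam_rate n M \<rho> p)"
      by (rule nn_integral_beam_rate[OF assms(1,2) p_nonneg])
    finally show "(\<integral>\<^sup>+X. ennreal (Y X) \<partial>?P) = ennreal (beam_rate n M \<rho> p)" .
    show "0 \<le> beam_rate n M \<rho> p" by (rule nn_integral_beam_rate[OF assms(1,2) p_nonneg])
  qed
  hence "has_bochner_integral ?P (\<lambda>X. \<Sum>m<M. ln (1 + Max ((\<lambda>i. trunc_sinr M \<rho> \<tau> X i m) ` {..<n})))
      (\<Sum>m<M. beam_rate n M \<rho> p)"
    by (intro has_bochner_integral_sum) auto
  thus ?thesis unfolding sum_rate_def by (simp add: has_bochner_integral_integral_eq)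
qed

section \<open>Schur-concavity of the rate and optimality of homogeneous thresholds\<close>

text \<open>Complements reverse the order:
  \<open>1 - z i \<le> 1 - a \<le> 1 - b \<le> 1 - z j\<close> take the roles of \<open>a\<close>,
  \<open>a'\<close>, \<open>b'\<close>, \<open>b\<close> in the spread integral. The other users
  form the weight \<open>G\<close>, and the rate difference is exactly that integral.\<close>

lemma beam_rate_transfer:
  assumes "\<rho> > 0" "M > 1" "\<forall>k<n. z k \<in> {0..1}" "i < n" "j < n" "i \<noteq> j"
    and "z j \<le> b" "b \<le> a" "a \<le> z i" "a + b = z i + z j"
  shows "beam_rate n M \<rho> z \<le> beam_rate n M \<rho> (z(i := a, j := b))"
\<comment> \<open>If \<open>a = z i\<close>, the equal sums force \<open>b = z j\<close> and nothing
  moves; otherwise the outer inequalities are strict, as the spread integral demands.\<close>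
proof (cases "a = z i")
  case True
  hence "z(i := a, j := b) = z" using assms by (auto simp: fun_eq_iff)
  thus ?thesis by simp
next
  case False
  define z' where "z' = z(i := a, j := b)"
  let ?F = "log_cdf M \<rho>"
  define G where "G = (\<lambda>u. \<Prod>k\<in>{..<n} - {i, j}. max (?F u) (1 - z k))"
  let ?d = "\<lambda>v. max v (1 - z i) * max v (1 - z j) - max v (1 - a) * max v (1 - b)"
  have zij: "0 \<le> z j" "z i \<le> 1" "0 \<le> z i" "z j \<le> 1" using assms by auto
  have split: "(\<Prod>k<n. max v (1 - w k))
      = (\<Prod>k\<in>{..<n} - {i, j}. max v (1 - w k)) * (max v (1 - w i) * max v (1 - w j))"
    for w :: "nat \<Rightarrow> real" and v :: real
  proof -
    have "{..<n} = insert i (insert j ({..<n} - {i, j}))" using assms by auto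
    hence "(\<Prod>k<n. max v (1 - w k)) = (\<Prod>k\<in>insert i (insert j ({..<n} - {i, j})). max v (1 - w k))"
      by simp
    thus ?thesis using assms by (simp add: mult_ac)
  qed
  have diff: "(1 - (\<Prod>k<n. max (?F u) (1 - z' k))) - (1 - (\<Prod>k<n. max (?F u) (1 - z k))) = G u * ?d (?F u)" for u
  proof -
    have "(\<Prod>k\<in>{..<n} - {i, j}. max (?F u) (1 - z' k)) = G u"
      unfolding G_def by (intro prod.cong) (auto simp: z'_def)
    thus ?thesis unfolding split G_def[symmetric] using assms(6)
      by (simp add: z'_def algebra_simps G_def)
  qed
  have int_z: "set_integrable lborel {0..} (\<lambda>u. 1 - (\<Prod>k<n. max (?F u) (1 - z k)))"
    using assms by (intro beam_rate_integrable) auto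
  have int_z': "set_integrable lborel {0..} (\<lambda>u. 1 - (\<Prod>k<n. max (?F u) (1 - z' k)))"
    using assms zij by (intro beam_rate_integrable) (auto simp: z'_def)
  have "0 \<le> (LINT u:{0..}|lborel. G u * ?d (?F u))"
  proof (rule concave_cdf_spread_integral_nonneg[where f = "log_pdf M \<rho>"])
    show "set_integrable lborel {0..} (\<lambda>u. G u * ?d (?F u))"
      using set_integral_diff(1)[OF int_z' int_z] by (simp add: diff)
    show "log_pdf M \<rho> \<in> borel_measurable borel"
      by (intro borel_measurable_continuous_onI continuous_on_log_pdf)
    show "0 < log_pdf M \<rho> u" if "0 \<le> u" for u
      unfolding log_pdf_def using log_cdf_bounds[OF that assms(1)] assms(1,2)
      by (intro mult_pos_pos add_pos_nonneg) auto
    show "G u \<le> G v" if "0 \<le> u" "u \<le> v" for u v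
      unfolding G_def using log_cdf_mono[OF that assms(1), of M] log_cdf_bounds[OF that(1) assms(1), of M]
      by (intro prod_mono) auto
    show "0 \<le> G u" if "0 \<le> u" for u
      unfolding G_def using log_cdf_bounds[OF that assms(1), of M] by (intro prod_nonneg) auto
    show "log_cdf M \<rho> 0 = 0" by (simp add: log_cdf_def)
  qed (use assms zij False log_cdf_deriv continuous_on_log_pdf log_cdf_tendsto log_pdf_antimono in auto)
  also have "\<dots> = beam_rate n M \<rho> z' - beam_rate n M \<rho> z"
    unfolding beam_rate_def using set_integral_diff(2)[OF int_z' int_z] by (simp add: diff)
  finally show ?thesis by (simp add: z'_def)
qed

lemma schur_concave_beam_rate:
  assumes "\<rho> > 0" "M > 1"
  shows "schur_concave_on n {p. \<forall>i<n. 0 \<le> p i \<and> p i \<le> 1} (beam_rate n M \<rho>)"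
proof (rule schur_concave_onI)
  fix z z' :: "nat \<Rightarrow> real"
  assume eq: "mset (map z [0..<n]) = mset (map z' [0..<n])"
  \<comment> \<open>The integrand sees the probabilities only through a product over users, hence
    only through their multiset.\<close>
  have "(\<Prod>i<n. g (w i)) = prod_mset (image_mset g (mset (map w [0..<n])))" for g w :: "_ \<Rightarrow> real"
    by (simp add: prod_unfold_prod_mset atLeast0LessThan image_mset.compositionality o_def)
  hence "(\<Prod>i<n. g (z i)) = (\<Prod>i<n. g (z' i))" for g :: "real \<Rightarrow> real" by (simp only: eq)
  from this[of "\<lambda>y. max _ (1 - y)"] show "beam_rate n M \<rho> z = beam_rate n M \<rho> z'"
    unfolding beam_rate_def by simp
qed (rule beam_rate_transfer[OF assms])

theorem theorem3:
  fixes n M :: nat and \<rho> :: real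
  assumes "n \<ge> 2" and "M > 1" and "\<rho> > 0"
  shows "schur_concave_on n {p. \<forall>i<n. 0 \<le> p i \<and> p i \<le> 1} (sum_rate_p n M \<rho>)
     \<and> (\<forall>lam::real. 0 < lam \<and> lam \<le> real n \<longrightarrow>
          (\<forall>\<tau>::nat \<Rightarrow> ereal. (\<forall>i<n. 0 \<le> \<tau> i) \<and> (\<Sum>i<n. feedback_prob n M \<rho> \<tau> i) \<le> lam \<longrightarrow>
             (\<exists>t::ereal. 0 \<le> t \<and> (\<Sum>i<n. feedback_prob n M \<rho> (\<lambda>_. t) i) \<le> lam
                \<and> sum_rate n M \<rho> (\<lambda>_. t) \<ge> sum_rate n M \<rho> \<tau>)))"
proof (intro conjI allI impI)
  have rate_p: "sum_rate_p n M \<rho> p = M * beam_rate n M \<rho> p" if "\<forall>i<n. 0 \<le> p i \<and> p i \<le> 1" for p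
    unfolding sum_rate_p_def using assms that
    by (intro sum_rate_eq_beam_rate) (auto simp: sinr_tail_tau_of_prob)
  have schur: "schur_concave_on n {p. \<forall>i<n. 0 \<le> p i \<and> p i \<le> 1} (beam_rate n M \<rho>)"
    using assms by (intro schur_concave_beam_rate)
  show "schur_concave_on n {p. \<forall>i<n. 0 \<le> p i \<and> p i \<le> 1} (sum_rate_p n M \<rho>)"
    using schur by (auto simp: schur_concave_on_def rate_p intro!: mult_left_mono)
  fix lam :: real and \<tau> :: "nat \<Rightarrow> ereal"
  assume \<tau>: "(\<forall>i<n. 0 \<le> \<tau> i) \<and> (\<Sum>i<n. feedback_prob n M \<rho> \<tau> i) \<le> lam"
  define p where "p = (\<lambda>i. sinr_tail M \<rho> (\<tau> i))"
  \<comment> \<open>The homogeneous policy gives every user the average feedback probability. Its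
    total load equals that of \<open>\<tau>\<close>, and the constant vector is majorized by
    \<open>p\<close>, so its rate is at least as large.\<close>
  define \<mu> where "\<mu> = (\<Sum>i<n. p i) / n"
  define t where "t = tau_of_prob M \<rho> \<mu>"
  have p: "\<forall>i<n. 0 \<le> p i \<and> p i \<le> 1" using \<tau> assms sinr_tail_bounds by (auto simp: p_def)
  have "(\<Sum>i<n. p i) \<le> (\<Sum>i<n. 1)" using p by (intro sum_mono) auto
  hence \<mu>: "0 \<le> \<mu>" "\<mu> \<le> 1"
    using p assms by (auto simp: \<mu>_def divide_le_eq intro!: divide_nonneg_nonneg sum_nonneg)
  note t = sinr_tail_tau_of_prob[OF \<mu> assms(3), of M, folded t_def]
  have "(\<Sum>i<n. feedback_prob n M \<rho> (\<lambda>_. t) i) = (\<Sum>i<n. \<mu>)"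
    using t assms by (intro sum.cong) (auto simp: feedback_prob_eq_sinr_tail)
  also have "\<dots> = (\<Sum>i<n. p i)" using assms by (simp add: \<mu>_def)
  also have "\<dots> = (\<Sum>i<n. feedback_prob n M \<rho> \<tau> i)"
    using \<tau> assms by (intro sum.cong) (auto simp: feedback_prob_eq_sinr_tail p_def)
  also have "\<dots> \<le> lam" using \<tau> by blast
  finally have "(\<Sum>i<n. feedback_prob n M \<rho> (\<lambda>_. t) i) \<le> lam" .
  moreover have "sum_rate n M \<rho> \<tau> \<le> sum_rate n M \<rho> (\<lambda>_. t)"
  proof -
    have "sum_rate n M \<rho> \<tau> = M * beam_rate n M \<rho> p"
      using \<tau> assms by (intro sum_rate_eq_beam_rate) (auto simp: p_def)
    also have "\<dots> \<le> M * beam_rate n M \<rho> (\<lambda>_. \<mu>)"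
      using schur majorizes_mean[of n p] p \<mu> assms
      by (intro mult_left_mono) (auto simp: schur_concave_on_def \<mu>_def)
    also have "\<dots> = sum_rate n M \<rho> (\<lambda>_. t)"
      using t assms by (intro sum_rate_eq_beam_rate[symmetric]) auto
    finally show ?thesis .
  qed
  ultimately show "\<exists>t\<ge>0. (\<Sum>i<n. feedback_prob n M \<rho> (\<lambda>_. t) i) \<le> lam
      \<and> sum_rate n M \<rho> \<tau> \<le> sum_rate n M \<rho> (\<lambda>_. t)" using t by blast
qed

end
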